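(* Every edge of a Bruhat interval polytope for $G/P_J$ corresponds to a cover relation in the (strong) Bruhat order. That is, if $u\leq v$ in $W$ with $v\in W^J$ and $E$ is an edge of $\mathsf{Q}^J_{u,v}$, then there exist $x\lessdot y$ in $W$ such that $E=\mathrm{Conv}\{x\cdot\rho_J,\,y\cdot\rho_J\}$.
   Context: $G$ is a semisimple, simply connected linear algebraic group over $\mathbb{C}$, split over $\mathbb{R}$, with split maximal torus $T$, Borel subgroup $B\supset T$, simple roots indexed by $I$, fundamental weights $\omega_i$ ($i\in I$), and Weyl group $W$ with simple reflections $s_i$ and Bruhat order $\leq$ (cover relation $\lessdot$); $\mathfrak{t}^*_{\mathbb{R}}$ is the real dual of the Lie algebra of $T$, on which $W$ acts. For $J\subset I$, $W_J=\langle s_j:j\in J\rangle$, $P_J\supset B$ is the corresponding parabolic subgroup, $W^J$ is the set of minimal-length coset representatives of $W/W_J$, and $\rho_J=\sum_{i\in I\setminus J}\omega_i$ (whose stabilizer in $W$ is $W_J$). For $u\leq v$ in $W$ with $v\in W^J$, the Bruhat interval polytope for $G/P_J$ is $\mathsf{Q}^J_{u,v}=\mathrm{Conv}\{z\cdot\rho_J\mid u\leq z\leq v\}\subset\mathfrak{t}^*_{\mathbb{R}}$. *)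

theory Defs
  imports "HOL-Analysis.Analysis"
begin

(* The pair (G, T) enters the statement only through its root system Phi, regarded as a subset of
   a Euclidean space whose inner product plays the role of a W-invariant one, and the choice of B
   through the base Delta of simple roots. The space of real weights is span Phi = span Delta; the
   roots need not span the ambient type, which covers the trivial group as well as the usual
   coordinate models such as type A_(n-1) inside R^n. The index set I is Delta itself, so that a
   subset J of I is a set of simple roots. *)

definition cartan_pairing :: "'a::euclidean_space \<Rightarrow> 'a \<Rightarrow> real" where
  "cartan_pairing x \<alpha> = 2 * (x \<bullet> \<alpha>) / (\<alpha> \<bullet> \<alpha>)"

definition root_reflection :: "'a::euclidean_space \<Rightarrow> 'a \<Rightarrow> 'a" where
  "root_reflection \<alpha> x = x - cartan_pairing x \<alpha> *\<^sub>R \<alpha>"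

definition root_system :: "'a::euclidean_space set \<Rightarrow> bool" where
  "root_system \<Phi> \<longleftrightarrow>
     finite \<Phi> \<and> 0 \<notin> \<Phi> \<and>
     (\<forall>\<alpha>\<in>\<Phi>. root_reflection \<alpha> ` \<Phi> = \<Phi>) \<and>
     (\<forall>\<alpha>\<in>\<Phi>. \<forall>\<beta>\<in>\<Phi>. cartan_pairing \<beta> \<alpha> \<in> \<int>) \<and>
     (\<forall>\<alpha>\<in>\<Phi>. \<forall>c. c *\<^sub>R \<alpha> \<in> \<Phi> \<longrightarrow> c = 1 \<or> c = -1)"

definition simple_roots :: "'a::euclidean_space set \<Rightarrow> 'a set \<Rightarrow> bool" where
  "simple_roots \<Phi> \<Delta> \<longleftrightarrow>
     \<Delta> \<subseteq> \<Phi> \<and> independent \<Delta> \<and>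
     (\<forall>\<beta>\<in>\<Phi>. \<exists>c :: 'a \<Rightarrow> nat.
        \<beta> = (\<Sum>\<alpha>\<in>\<Delta>. real (c \<alpha>) *\<^sub>R \<alpha>) \<or> \<beta> = - (\<Sum>\<alpha>\<in>\<Delta>. real (c \<alpha>) *\<^sub>R \<alpha>))"

definition fundamental_weight :: "'a::euclidean_space set \<Rightarrow> 'a \<Rightarrow> 'a" where
  "fundamental_weight \<Delta> \<alpha> =
     (THE w. w \<in> span \<Delta> \<and> (\<forall>\<beta>\<in>\<Delta>. cartan_pairing w \<beta> = (if \<beta> = \<alpha> then 1 else 0)))"

lemma fundamental_weight_ex1:
  fixes \<Delta> :: "'a::euclidean_space set"
  assumes ind: "independent \<Delta>"
  shows "\<exists>!w. w \<in> span \<Delta> \<and> (\<forall>\<beta>\<in>\<Delta>. cartan_pairing w \<beta> = (if \<beta> = \<alpha> then 1 else 0))"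
proof (rule ex_ex1I)
  obtain f :: "'a \<Rightarrow> real" where f: "linear f"
    "\<forall>\<beta>\<in>\<Delta>. f \<beta> = (if \<beta> = \<alpha> then (\<beta> \<bullet> \<beta>) / 2 else 0)"
    using linear_independent_extend[OF ind,
        of "\<lambda>\<beta>. if \<beta> = \<alpha> then (\<beta> \<bullet> \<beta>) / 2 else 0"] by auto
  obtain y z where yz: "y \<in> span \<Delta>" "\<And>w. w \<in> span \<Delta> \<Longrightarrow> orthogonal z w"
    "adjoint f 1 = y + z"
    using orthogonal_subspace_decomp_exists[of \<Delta> "adjoint f 1"] by metis
  have "y \<bullet> \<beta> = f \<beta>" if "\<beta> \<in> \<Delta>" for \<beta>
  proof -
    have "adjoint f 1 \<bullet> \<beta> = f \<beta>"
      using adjoint_works[OF f(1), of \<beta> 1] by (simp add: inner_commute)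
    moreover have "z \<bullet> \<beta> = 0"
      using yz(2)[OF span_base[OF that]] by (simp add: orthogonal_def)
    ultimately show ?thesis using yz(3) by (simp add: inner_add_left)
  qed
  moreover have "\<beta> \<noteq> 0" if "\<beta> \<in> \<Delta>" for \<beta>
    using ind that by (auto dest: dependent_zero)
  ultimately show "\<exists>w. w \<in> span \<Delta> \<and> (\<forall>\<beta>\<in>\<Delta>. cartan_pairing w \<beta> = (if \<beta> = \<alpha> then 1 else 0))"
    using yz(1) f(2) by (intro exI[of _ y]) (auto simp: cartan_pairing_def)
next
  fix v w
  assume v: "v \<in> span \<Delta> \<and> (\<forall>\<beta>\<in>\<Delta>. cartan_pairing v \<beta> = (if \<beta> = \<alpha> then 1 else 0))"
    and w: "w \<in> span \<Delta> \<and> (\<forall>\<beta>\<in>\<Delta>. cartan_pairing w \<beta> = (if \<beta> = \<alpha> then 1 else 0))"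
  have "orthogonal (v - w) \<beta>" if "\<beta> \<in> \<Delta>" for \<beta>
  proof -
    have "\<beta> \<noteq> 0" using ind that by (auto dest: dependent_zero)
    moreover have "cartan_pairing v \<beta> = cartan_pairing w \<beta>" using v w that by simp
    ultimately show ?thesis
      by (simp add: cartan_pairing_def orthogonal_def inner_diff_left)
  qed
  then have "orthogonal (v - w) (v - w)"
    by (rule orthogonal_to_span[rotated]) (use v w span_diff in auto)
  then show "v = w" by (simp add: orthogonal_self)
qed

(* W and its parabolic subgroups W_J are realised as groups of linear maps; since reflections are
   involutions, words in the generators already form the generated subgroup. *)

definition word_map :: "'a::euclidean_space list \<Rightarrow> 'a \<Rightarrow> 'a" where
  "word_map as = foldr (\<lambda>\<alpha> w. root_reflection \<alpha> \<circ> w) as id"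

definition weyl_group :: "'a::euclidean_space set \<Rightarrow> ('a \<Rightarrow> 'a) set" where
  "weyl_group D = word_map ` lists D"

definition weyl_length :: "'a::euclidean_space set \<Rightarrow> ('a \<Rightarrow> 'a) \<Rightarrow> nat" where
  "weyl_length \<Delta> w = (LEAST n. \<exists>as\<in>lists \<Delta>. length as = n \<and> word_map as = w)"

(* The reflections of W (the conjugates of the simple ones) are the reflections in the roots. *)

definition bruhat_step ::
    "'a::euclidean_space set \<Rightarrow> 'a set \<Rightarrow> ('a \<Rightarrow> 'a) \<Rightarrow> ('a \<Rightarrow> 'a) \<Rightarrow> bool" where
  "bruhat_step \<Phi> \<Delta> x y \<longleftrightarrow>
     (\<exists>\<beta>\<in>\<Phi>. y = x \<circ> root_reflection \<beta>) \<and> weyl_length \<Delta> x < weyl_length \<Delta> y"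

definition bruhat_le ::
    "'a::euclidean_space set \<Rightarrow> 'a set \<Rightarrow> ('a \<Rightarrow> 'a) \<Rightarrow> ('a \<Rightarrow> 'a) \<Rightarrow> bool" where
  "bruhat_le \<Phi> \<Delta> x y \<longleftrightarrow>
     x \<in> weyl_group \<Delta> \<and> y \<in> weyl_group \<Delta> \<and> (bruhat_step \<Phi> \<Delta>)\<^sup>*\<^sup>* x y"

definition bruhat_covers ::
    "'a::euclidean_space set \<Rightarrow> 'a set \<Rightarrow> ('a \<Rightarrow> 'a) \<Rightarrow> ('a \<Rightarrow> 'a) \<Rightarrow> bool" where
  "bruhat_covers \<Phi> \<Delta> x y \<longleftrightarrow>
     bruhat_le \<Phi> \<Delta> x y \<and> x \<noteq> y \<and>
     (\<forall>z. bruhat_le \<Phi> \<Delta> x z \<and> bruhat_le \<Phi> \<Delta> z y \<longrightarrow> z = x \<or> z = y)"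

definition min_coset_reps :: "'a::euclidean_space set \<Rightarrow> 'a set \<Rightarrow> ('a \<Rightarrow> 'a) set" where
  "min_coset_reps \<Delta> J =
     {w \<in> weyl_group \<Delta>. \<forall>x\<in>weyl_group J. weyl_length \<Delta> w \<le> weyl_length \<Delta> (w \<circ> x)}"

definition rho :: "'a::euclidean_space set \<Rightarrow> 'a set \<Rightarrow> 'a" where
  "rho \<Delta> J = (\<Sum>\<alpha>\<in>\<Delta> - J. fundamental_weight \<Delta> \<alpha>)"

definition bruhat_interval_polytope ::
    "'a::euclidean_space set \<Rightarrow> 'a set \<Rightarrow> 'a set \<Rightarrow> ('a \<Rightarrow> 'a) \<Rightarrow> ('a \<Rightarrow> 'a) \<Rightarrow> 'a set" where
  "bruhat_interval_polytope \<Phi> \<Delta> J u v =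
     convex hull {z (rho \<Delta> J) | z. bruhat_le \<Phi> \<Delta> u z \<and> bruhat_le \<Phi> \<Delta> z v}"

end

theory Submission
  imports Defs "HOL-Computational_Algebra.Polynomial"
begin

text \<open>
  Write \<open>\<rho>\<close> for the dominant weight and let \<open>f\<close> be a linear functional that vanishes on no root.  The
  heart of the proof is the following optimisation property (\<open>common_optimum\<close>): on a Bruhat interval
  \<open>[u, v]\<close>, every element can be joined to one and the same element \<open>m\<close> by a sequence of cover relations
  of the interval along which the value \<open>f (z \<rho>)\<close> never decreases.

  This gives the theorem.  All points \<open>z \<rho>\<close> have the same norm, so an edge \<open>E\<close> contains only its two
  endpoints \<open>p\<close> and \<open>q\<close> among them.  Tilt the functional that exposes \<open>E\<close> slightly towards \<open>q\<close> and make
  it generic: then \<open>q\<close> is the best point, \<open>p\<close> the second best, and all others are worse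
  (\<open>functional_of_edge\<close>).  A sequence of improving cover relations that starts over \<open>p\<close> has to end
  over \<open>q\<close>, and it can never visit any other point.  So one of its cover relations leads from an
  element over \<open>p\<close> to an element over \<open>q\<close>.  Both points may have several preimages, since \<open>\<rho>\<close>
  need not be regular.

  For the optimisation property, list the positive roots by a reduced word of the longest element
  in such a way that those with \<open>f < 0\<close> come first; call these two parts \<open>L\<close> and \<open>L'\<close>.  Label the
  cover relation from \<open>x\<close> to \<open>s\<^sub>\<gamma> x\<close> by the positive root \<open>\<gamma>\<close>.  It moves the point \<open>x \<rho>\<close> by a
  nonpositive multiple of \<open>\<gamma>\<close>, so going up is an improvement for labels in \<open>L\<close>, and going down is one
  for labels in \<open>L'\<close>.  The crucial fact is Dyer's theorem that there is exactly one saturated chain from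
  \<open>u\<close> to \<open>v\<close> whose labels occur in the order of the list.  The element at which this chain passes from
  \<open>L\<close> to \<open>L'\<close> is the only one that is reached from \<open>u\<close> by an \<open>L\<close>-chain and reaches \<open>v\<close> by an
  \<open>L'\<close>-chain, both with labels in the order of the list (\<open>unique_peak\<close>); it is the desired \<open>m\<close>.  Indeed,
  any \<open>z\<close> in \<open>[u, v]\<close> can be improved to the peak of \<open>[z, v]\<close> and to the peak of \<open>[u, z]\<close>, and if both
  of these are \<open>z\<close> itself, then \<open>z\<close> is the peak of \<open>[u, v]\<close>.

  Dyer's theorem is proved by counting all label-monotone paths in the Bruhat graph with a
  generating polynomial.  Running through a list of labels intertwines two twisted forms of the right
  action of a Hecke algebra generator (\<open>gallery_hecke\<close>), hence for the full list the generating
  polynomials obey the recursion of the R-polynomials.  Together with the lifting property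
  this shows that the coefficient which counts the saturated chains is one (\<open>coeff_fold_arrow_longest\<close>).
\<close>

section \<open>Reflections and words\<close>

lemma linear_root_reflection: "linear (root_reflection \<alpha>)"
  by (rule linearI)
    (simp_all add: root_reflection_def cartan_pairing_def inner_add_left algebra_simps
      add_divide_distrib)

lemma root_reflection_invol [simp]: "root_reflection \<alpha> (root_reflection \<alpha> x) = x"
  by (cases "\<alpha> = 0")
    (simp_all add: root_reflection_def cartan_pairing_def inner_diff_left algebra_simps
      diff_divide_distrib flip: scaleR_add_left)

lemma root_reflection_comp_self [simp]: "root_reflection \<alpha> \<circ> root_reflection \<alpha> = id"
  by auto

lemma root_reflection_comp_self_assoc [simp]:
  "root_reflection \<alpha> \<circ> (root_reflection \<alpha> \<circ> f) = f"
  by (auto simp: fun_eq_iff)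

lemma root_reflection_inner: "root_reflection \<alpha> x \<bullet> root_reflection \<alpha> y = x \<bullet> y"
  by (cases "\<alpha> = 0")
    (simp_all add: root_reflection_def cartan_pairing_def inner_diff_left inner_diff_right
      inner_commute field_simps)

lemma orthogonal_transformation_root_reflection:
  "orthogonal_transformation (root_reflection \<alpha>)"
  by (simp add: orthogonal_transformation_def linear_root_reflection root_reflection_inner)

lemma root_reflection_self: "\<alpha> \<noteq> 0 \<Longrightarrow> root_reflection \<alpha> \<alpha> = - \<alpha>"
  by (simp add: root_reflection_def cartan_pairing_def scaleR_2)

lemma root_reflection_uminus [simp]: "root_reflection (- \<alpha>) = root_reflection \<alpha>"
  by (simp add: root_reflection_def cartan_pairing_def fun_eq_iff)

lemma orthogonal_transformation_conj_reflection:
  assumes "orthogonal_transformation z"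
  shows "z \<circ> root_reflection \<gamma> = root_reflection (z \<gamma>) \<circ> z"
proof -
  have "linear z" "\<And>x y. z x \<bullet> z y = x \<bullet> y"
    using assms by (auto simp: orthogonal_transformation_def)
  then show ?thesis
    by (simp add: fun_eq_iff root_reflection_def cartan_pairing_def linear_diff linear_cmul)
qed

lemma word_map_Nil [simp]: "word_map [] = id"
  by (simp add: word_map_def)

lemma word_map_Cons [simp]: "word_map (\<alpha> # as) = root_reflection \<alpha> \<circ> word_map as"
  by (simp add: word_map_def)

lemma word_map_append: "word_map (as @ bs) = word_map as \<circ> word_map bs"
  by (induction as) (simp_all add: comp_assoc)

lemma word_map_rev_comp: "word_map (rev as) \<circ> word_map as = id"
  by (induction as) (simp_all add: word_map_append comp_assoc)

lemma word_map_comp_rev: "word_map as \<circ> word_map (rev as) = id"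
  using word_map_rev_comp[of "rev as"] by simp

lemma orthogonal_transformation_word_map: "orthogonal_transformation (word_map as)"
proof (induction as)
  case Nil
  show ?case by (simp add: orthogonal_transformation_id id_def)
next
  case (Cons \<alpha> as)
  then show ?case
    unfolding word_map_Cons
    by (rule orthogonal_transformation_compose[OF orthogonal_transformation_root_reflection])
qed

lemma inv_word_map: "inv (word_map as) = word_map (rev as)"
  by (rule inv_unique_comp) (simp_all add: word_map_rev_comp word_map_comp_rev)

section \<open>Positive roots and the Weyl group\<close>

locale based_root_system =
  fixes \<Phi> \<Delta> :: "'a::euclidean_space set"
  assumes root_system: "root_system \<Phi>"
    and simple_roots: "simple_roots \<Phi> \<Delta>"
begin

text \<open>Inverses of elements of \<open>W\<close> are written with \<open>inv\<close>.  In the comments \<open>s\<^sub>\<gamma>\<close> is the reflection \<open>refl \<gamma>\<close>,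
  and for a simple root \<open>r\<close> the product of \<open>z\<close> and \<open>s\<^sub>r\<close> is abbreviated to \<open>z r\<close>.\<close>

abbreviation W where "W \<equiv> weyl_group \<Delta>"
abbreviation len where "len \<equiv> weyl_length \<Delta>"
abbreviation le where "le \<equiv> bruhat_le \<Phi> \<Delta>"
abbreviation refl where "refl \<equiv> root_reflection :: 'a \<Rightarrow> 'a \<Rightarrow> 'a"

definition pos :: "'a \<Rightarrow> bool" where
  "pos \<beta> \<longleftrightarrow> \<beta> \<in> \<Phi> \<and> (\<exists>c :: 'a \<Rightarrow> nat. \<beta> = (\<Sum>\<alpha>\<in>\<Delta>. real (c \<alpha>) *\<^sub>R \<alpha>))"

lemma finite_roots: "finite \<Phi>" and zero_notin_roots: "0 \<notin> \<Phi>"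
  and reduced: "\<lbrakk>\<alpha> \<in> \<Phi>; c *\<^sub>R \<alpha> \<in> \<Phi>\<rbrakk> \<Longrightarrow> c = 1 \<or> c = -1"
  using root_system by (auto simp: root_system_def)

lemma refl_root: "\<lbrakk>\<alpha> \<in> \<Phi>; \<beta> \<in> \<Phi>\<rbrakk> \<Longrightarrow> refl \<alpha> \<beta> \<in> \<Phi>"
  using root_system unfolding root_system_def by blast

lemma refl_self_root: "\<alpha> \<in> \<Phi> \<Longrightarrow> refl \<alpha> \<alpha> = - \<alpha>"
  by (rule root_reflection_self) (use zero_notin_roots in auto)

lemma root_uminus: "\<beta> \<in> \<Phi> \<Longrightarrow> - \<beta> \<in> \<Phi>"
  using refl_root[of \<beta> \<beta>] root_reflection_self[of \<beta>] zero_notin_roots by metis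

lemma simple_subset: "\<Delta> \<subseteq> \<Phi>" and independent_simple: "independent \<Delta>"
  using simple_roots by (auto simp: simple_roots_def)

lemma simple_root: "\<alpha> \<in> \<Delta> \<Longrightarrow> \<alpha> \<in> \<Phi>"
  using simple_subset by blast

lemma finite_simple: "finite \<Delta>"
  using simple_subset finite_roots finite_subset by blast

lemma simple_coeffs_zero:
  "\<lbrakk>(\<Sum>\<alpha>\<in>\<Delta>. c \<alpha> *\<^sub>R \<alpha>) = 0; \<alpha> \<in> \<Delta>\<rbrakk> \<Longrightarrow> c \<alpha> = 0"
  using independentD[OF independent_simple finite_simple order_refl] by blast

lemma pos_root: "pos \<beta> \<Longrightarrow> \<beta> \<in> \<Phi>"
  by (simp add: pos_def)

lemma pos_or_neg:
  assumes "\<beta> \<in> \<Phi>" shows "pos \<beta> \<or> pos (- \<beta>)"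
proof -
  obtain c :: "'a \<Rightarrow> nat" where
    "\<beta> = (\<Sum>\<alpha>\<in>\<Delta>. real (c \<alpha>) *\<^sub>R \<alpha>) \<or> \<beta> = - (\<Sum>\<alpha>\<in>\<Delta>. real (c \<alpha>) *\<^sub>R \<alpha>)"
    using simple_roots assms unfolding simple_roots_def by blast
  then have "\<beta> = (\<Sum>\<alpha>\<in>\<Delta>. real (c \<alpha>) *\<^sub>R \<alpha>) \<or> - \<beta> = (\<Sum>\<alpha>\<in>\<Delta>. real (c \<alpha>) *\<^sub>R \<alpha>)"
    by auto
  then show ?thesis using assms root_uminus[OF assms] unfolding pos_def by blast
qed

lemma not_pos_and_neg:
  assumes "pos \<beta>" "pos (- \<beta>)" shows False
proof -
  obtain c d :: "'a \<Rightarrow> nat" where c: "\<beta> = (\<Sum>\<alpha>\<in>\<Delta>. real (c \<alpha>) *\<^sub>R \<alpha>)"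
    and d: "- \<beta> = (\<Sum>\<alpha>\<in>\<Delta>. real (d \<alpha>) *\<^sub>R \<alpha>)"
    using assms by (auto simp: pos_def)
  have "(\<Sum>\<alpha>\<in>\<Delta>. (real (c \<alpha>) + real (d \<alpha>)) *\<^sub>R \<alpha>) = 0"
    using c d by (simp add: scaleR_add_left sum.distrib) (metis add.right_inverse)
  then have "real (c \<alpha>) + real (d \<alpha>) = 0" if "\<alpha> \<in> \<Delta>" for \<alpha>
    using simple_coeffs_zero[of "\<lambda>\<alpha>. real (c \<alpha>) + real (d \<alpha>)"] that by blast
  then have "\<beta> = 0" using c by (simp add: add_nonneg_eq_0_iff)
  then show False using assms pos_root zero_notin_roots by blast
qed

lemma pos_uminus: "\<beta> \<in> \<Phi> \<Longrightarrow> pos (- \<beta>) \<longleftrightarrow> \<not> pos \<beta>"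
  using pos_or_neg not_pos_and_neg by blast

lemma sum_single_simple:
  assumes "\<alpha> \<in> \<Delta>"
  shows "(\<Sum>\<delta>\<in>\<Delta>. (if \<delta> = \<alpha> then x else 0) *\<^sub>R \<delta>) = x *\<^sub>R \<alpha>"
proof -
  have "(\<Sum>\<delta>\<in>\<Delta>. (if \<delta> = \<alpha> then x else 0) *\<^sub>R \<delta>) = (\<Sum>\<delta>\<in>\<Delta>. if \<delta> = \<alpha> then x *\<^sub>R \<alpha> else 0)"
    by (rule sum.cong) auto
  then show ?thesis using assms finite_simple by simp
qed

lemma pos_simple: assumes "\<alpha> \<in> \<Delta>" shows "pos \<alpha>"
proof -
  have "(\<Sum>\<delta>\<in>\<Delta>. real (if \<delta> = \<alpha> then 1 else 0) *\<^sub>R \<delta>) = \<alpha>"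
    using sum_single_simple[OF assms, of 1] by (simp add: if_distrib[of real] cong: if_cong)
  then show ?thesis
    unfolding pos_def using simple_root[OF assms]
    by (intro conjI exI[of _ "\<lambda>\<delta>. if \<delta> = \<alpha> then 1 else 0"]) auto
qed

text \<open>A reflection in \<open>\<alpha>\<close> changes only the \<open>\<alpha>\<close>-coordinate of a root, and a positive root other than
  \<open>\<alpha>\<close> has another positive coordinate because the root system is reduced.\<close>

lemma pos_refl_simple:
  assumes \<alpha>: "\<alpha> \<in> \<Delta>" and \<beta>: "pos \<beta>" "\<beta> \<noteq> \<alpha>"
  shows "pos (refl \<alpha> \<beta>)"
proof (rule ccontr)
  let ?k = "cartan_pairing \<beta> \<alpha>"
  obtain c :: "'a \<Rightarrow> nat" where c: "\<beta> = (\<Sum>\<alpha>\<in>\<Delta>. real (c \<alpha>) *\<^sub>R \<alpha>)"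
    using \<beta> by (auto simp: pos_def)
  have root: "refl \<alpha> \<beta> \<in> \<Phi>" using refl_root simple_root[OF \<alpha>] pos_root[OF \<beta>(1)] by blast
  assume "\<not> pos (refl \<alpha> \<beta>)"
  then have "pos (- refl \<alpha> \<beta>)" using pos_or_neg root by blast
  then obtain d :: "'a \<Rightarrow> nat" where d: "- refl \<alpha> \<beta> = (\<Sum>\<alpha>\<in>\<Delta>. real (d \<alpha>) *\<^sub>R \<alpha>)"
    by (auto simp: pos_def)
  note single = sum_single_simple[OF \<alpha>]
  have "(\<Sum>\<delta>\<in>\<Delta>. (real (c \<delta>) + real (d \<delta>) - (if \<delta> = \<alpha> then ?k else 0)) *\<^sub>R \<delta>) =
      \<beta> + - refl \<alpha> \<beta> - ?k *\<^sub>R \<alpha>"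
    unfolding d by (subst (2) c) (simp only: scaleR_add_left scaleR_diff_left sum.distrib
      sum_subtractf single)
  also have "\<dots> = 0" by (simp add: root_reflection_def)
  finally have "real (c \<delta>) + real (d \<delta>) - (if \<delta> = \<alpha> then ?k else 0) = 0" if "\<delta> \<in> \<Delta>" for \<delta>
    using that by (rule simple_coeffs_zero)
  then have "real (c \<delta>) = (if \<delta> = \<alpha> then real (c \<alpha>) else 0)" if "\<delta> \<in> \<Delta>" for \<delta>
    using that by (cases "\<delta> = \<alpha>") (fastforce simp: add_nonneg_eq_0_iff)+
  then have "\<beta> = (\<Sum>\<delta>\<in>\<Delta>. (if \<delta> = \<alpha> then real (c \<alpha>) else 0) *\<^sub>R \<delta>)"
    by (subst c) (auto intro: sum.cong)
  then have "\<beta> = real (c \<alpha>) *\<^sub>R \<alpha>" using single by simp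
  moreover have "real (c \<alpha>) = 1 \<or> real (c \<alpha>) = -1"
    using reduced[OF simple_root[OF \<alpha>]] pos_root[OF \<beta>(1)] calculation by metis
  ultimately show False using \<beta>(2) by auto
qed

lemma pos_refl_simple_iff:
  assumes "\<alpha> \<in> \<Delta>" "\<beta> \<in> \<Phi>" "\<beta> \<noteq> \<alpha>" "\<beta> \<noteq> - \<alpha>"
  shows "pos (refl \<alpha> \<beta>) \<longleftrightarrow> pos \<beta>"
proof (cases "pos \<beta>")
  case True
  then show ?thesis using pos_refl_simple assms by blast
next
  case False
  then have "pos (refl \<alpha> (- \<beta>))"
    using assms pos_or_neg by (metis minus_minus pos_refl_simple)
  then show ?thesis
    using False refl_root[OF simple_root] assms pos_uminus
    by (metis linear_neg linear_root_reflection)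
qed

lemma id_in_W [simp]: "id \<in> W"
  by (auto simp: weyl_group_def intro!: image_eqI[of _ _ "[]"])

lemma comp_in_W: "\<lbrakk>x \<in> W; y \<in> W\<rbrakk> \<Longrightarrow> x \<circ> y \<in> W"
  unfolding weyl_group_def by (auto intro!: imageI simp flip: word_map_append)

lemma simple_refl_in_W: "\<alpha> \<in> \<Delta> \<Longrightarrow> refl \<alpha> \<in> W"
  by (auto simp: weyl_group_def intro!: image_eqI[of _ _ "[\<alpha>]"])

lemma inv_in_W: "x \<in> W \<Longrightarrow> inv x \<in> W"
  by (auto simp: weyl_group_def inv_word_map)

lemma W_orthogonal: "x \<in> W \<Longrightarrow> orthogonal_transformation x"
  by (auto simp: weyl_group_def orthogonal_transformation_word_map)

lemma W_linear: "x \<in> W \<Longrightarrow> linear x"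
  using W_orthogonal orthogonal_transformation_def by blast

lemma W_bij: "x \<in> W \<Longrightarrow> bij x"
  using W_orthogonal orthogonal_transformation_bij by blast

lemma W_inner: "x \<in> W \<Longrightarrow> x a \<bullet> x b = a \<bullet> b"
  using W_orthogonal orthogonal_transformation_def by blast

lemma W_minus: "x \<in> W \<Longrightarrow> x (- a) = - x a"
  using W_linear linear_neg by blast

lemma W_inv_f [simp]: "x \<in> W \<Longrightarrow> inv x (x a) = a"
  using W_bij by (simp add: bij_is_inj)

lemma W_f_inv [simp]: "x \<in> W \<Longrightarrow> x (inv x a) = a"
  using W_bij by (simp add: bij_is_surj surj_f_inv_f)

lemma W_inv_comp [simp]: "x \<in> W \<Longrightarrow> inv x \<circ> x = id" "x \<in> W \<Longrightarrow> x \<circ> inv x = id"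
  by auto

lemma W_inv_inv: "x \<in> W \<Longrightarrow> inv (inv x) = x"
  using W_bij inv_inv_eq by blast

lemma W_comp_inv: "\<lbrakk>x \<in> W; y \<in> W\<rbrakk> \<Longrightarrow> inv (x \<circ> y) = inv y \<circ> inv x"
  using W_bij o_inv_distrib by blast

lemma W_inner_left: "x \<in> W \<Longrightarrow> x a \<bullet> b = a \<bullet> inv x b"
  using W_inner[of x a "inv x b"] by simp

lemma W_norm: "x \<in> W \<Longrightarrow> norm (x a) = norm a"
  using W_orthogonal orthogonal_transformation by blast

lemma W_root: "\<lbrakk>x \<in> W; \<beta> \<in> \<Phi>\<rbrakk> \<Longrightarrow> x \<beta> \<in> \<Phi>"
proof -
  have "as \<in> lists \<Delta> \<Longrightarrow> \<beta> \<in> \<Phi> \<Longrightarrow> word_map as \<beta> \<in> \<Phi>" for as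
    by (induction as) (auto simp: refl_root simple_root)
  then show "\<lbrakk>x \<in> W; \<beta> \<in> \<Phi>\<rbrakk> \<Longrightarrow> x \<beta> \<in> \<Phi>" by (auto simp: weyl_group_def)
qed

lemma W_refl: "x \<in> W \<Longrightarrow> x \<circ> refl \<gamma> = refl (x \<gamma>) \<circ> x"
  using W_orthogonal orthogonal_transformation_conj_reflection by blast

lemma W_refl_left: "x \<in> W \<Longrightarrow> refl \<gamma> \<circ> x = x \<circ> refl (inv x \<gamma>)"
  by (simp add: W_refl)

lemma inv_refl_comp:
  assumes "x \<in> W" "\<gamma> \<in> \<Phi>"
  shows "inv (refl \<gamma> \<circ> x) = inv x \<circ> refl \<gamma>"
proof (rule inv_unique_comp)
  show "(refl \<gamma> \<circ> x) \<circ> (inv x \<circ> refl \<gamma>) = id"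
    using assms by (auto simp: fun_eq_iff)
  show "(inv x \<circ> refl \<gamma>) \<circ> (refl \<gamma> \<circ> x) = id"
    using assms by (auto simp: fun_eq_iff)
qed

text \<open>An element of \<open>W\<close> fixes the orthogonal complement of the roots, so it is determined by the
  permutation of the roots that it induces.\<close>

lemma finite_W: "finite W"
proof (rule inj_on_finite)
  show "inj_on (\<lambda>x. restrict x \<Phi>) W"
  proof (rule inj_onI)
    fix x y assume xy: "x \<in> W" "y \<in> W" and eq: "restrict x \<Phi> = restrict y \<Phi>"
    have span: "x p = y p" if "p \<in> span \<Phi>" for p
    proof (rule linear_eq_on_span[OF W_linear W_linear _ that])
      show "x \<beta> = y \<beta>" if "\<beta> \<in> \<Phi>" for \<beta> using eq that by (metis restrict_apply')
    qed (use xy in auto)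
    have perp: "z c = c" if "\<And>\<beta>. \<beta> \<in> span \<Phi> \<Longrightarrow> orthogonal c \<beta>" "z \<in> W" for c z
    proof -
      have "refl \<alpha> c = c" if "\<alpha> \<in> \<Delta>" for \<alpha>
        using \<open>\<And>\<beta>. \<beta> \<in> span \<Phi> \<Longrightarrow> orthogonal c \<beta>\<close>[OF span_base[OF simple_root[OF that]]]
        by (simp add: root_reflection_def cartan_pairing_def orthogonal_def)
      then have "as \<in> lists \<Delta> \<Longrightarrow> word_map as c = c" for as
        by (induction as) auto
      then show ?thesis using \<open>z \<in> W\<close> by (auto simp: weyl_group_def)
    qed
    show "x = y"
    proof
      fix a
      obtain p c where pc: "p \<in> span \<Phi>" "\<And>\<beta>. \<beta> \<in> span \<Phi> \<Longrightarrow> orthogonal c \<beta>" "a = p + c"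
        using orthogonal_subspace_decomp_exists[of \<Phi> a] by metis
      then show "x a = y a"
        using xy span[OF pc(1)] perp[OF pc(2) xy(1)] perp[OF pc(2) xy(2)]
        by (simp add: linear_add W_linear)
    qed
  qed
  show "(\<lambda>x. restrict x \<Phi>) ` W \<subseteq> \<Phi> \<rightarrow>\<^sub>E \<Phi>" using W_root by auto
  show "finite (\<Phi> \<rightarrow>\<^sub>E \<Phi>)" using finite_roots by (simp add: finite_PiE)
qed

section \<open>Length and reflections\<close>

lemma len_word_le: "as \<in> lists \<Delta> \<Longrightarrow> len (word_map as) \<le> length as"
  unfolding weyl_length_def by (rule Least_le) auto

lemma reduced_word:
  assumes "x \<in> W" obtains as where "as \<in> lists \<Delta>" "word_map as = x" "length as = len x"
proof -
  have "\<exists>n. \<exists>as\<in>lists \<Delta>. length as = n \<and> word_map as = x"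
    using assms by (auto simp: weyl_group_def)
  from LeastI_ex[OF this] show thesis using that unfolding weyl_length_def by blast
qed

text \<open>The strong exchange property: read from the left, the word carries \<open>\<gamma>\<close> from a positive to a
  negative root, and at the letter where the sign changes the image of \<open>\<gamma>\<close> is that very simple root,
  so multiplying by the reflection cancels this letter.\<close>

lemma strong_exchange:
  assumes "as \<in> lists \<Delta>" "pos \<gamma>" "\<not> pos (inv (word_map as) \<gamma>)"
  shows "\<exists>bs\<in>lists \<Delta>. length bs < length as \<and> refl \<gamma> \<circ> word_map as = word_map bs"
  using assms
proof (induction as arbitrary: \<gamma>)
  case Nil
  then show ?case by (simp add: inv_id[unfolded id_def] id_def)
next
  case (Cons \<alpha> as)
  then have \<alpha>: "\<alpha> \<in> \<Delta>" and as: "as \<in> lists \<Delta>" by auto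
  show ?case
  proof (cases "\<gamma> = \<alpha>")
    case True
    then show ?thesis using as by (intro bexI[of _ as]) auto
  next
    case False
    have "pos (refl \<alpha> \<gamma>)" using pos_refl_simple \<alpha> Cons.prems False by blast
    moreover have "\<not> pos (inv (word_map as) (refl \<alpha> \<gamma>))"
      using Cons.prems(2) unfolding inv_word_map rev.simps word_map_append by simp
    ultimately obtain bs where bs: "bs \<in> lists \<Delta>" "length bs < length as"
      "refl (refl \<alpha> \<gamma>) \<circ> word_map as = word_map bs"
      using Cons.IH as by blast
    have "refl \<gamma> \<circ> word_map (\<alpha> # as) = refl \<alpha> \<circ> (refl (refl \<alpha> \<gamma>) \<circ> word_map as)"
      using orthogonal_transformation_conj_reflection[OF
          orthogonal_transformation_root_reflection, of \<alpha> "refl \<alpha> \<gamma>"]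
      by (metis comp_assoc root_reflection_invol word_map_Cons)
    then have "refl \<gamma> \<circ> word_map (\<alpha> # as) = word_map (\<alpha> # bs)"
      using bs(3) by (simp only: word_map_Cons)
    moreover have "\<alpha> # bs \<in> lists \<Delta>" "length (\<alpha> # bs) < length (\<alpha> # as)"
      using bs \<alpha> by auto
    ultimately show ?thesis by blast
  qed
qed

lemma refl_descent:
  assumes x: "x \<in> W" and \<gamma>: "pos \<gamma>" "\<not> pos (inv x \<gamma>)"
  shows "refl \<gamma> \<circ> x \<in> W" "len (refl \<gamma> \<circ> x) < len x"
proof -
  obtain as where as: "as \<in> lists \<Delta>" "word_map as = x" "length as = len x"
    using reduced_word x by blast
  then obtain bs where "bs \<in> lists \<Delta>" "length bs < length as" "refl \<gamma> \<circ> x = word_map bs"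
    using strong_exchange[OF as(1) \<gamma>(1)] \<gamma>(2) by auto
  then show "refl \<gamma> \<circ> x \<in> W" "len (refl \<gamma> \<circ> x) < len x"
    using len_word_le[of bs] as(3) by (auto simp: weyl_group_def)
qed

lemma pos_inner:
  assumes "pos \<beta>" "\<And>\<alpha>. \<alpha> \<in> \<Delta> \<Longrightarrow> 0 < g \<bullet> \<alpha>"
  shows "0 < g \<bullet> \<beta>"
proof -
  obtain c :: "'a \<Rightarrow> nat" where c: "\<beta> = (\<Sum>\<alpha>\<in>\<Delta>. real (c \<alpha>) *\<^sub>R \<alpha>)"
    using assms by (auto simp: pos_def)
  have "\<exists>\<alpha>\<in>\<Delta>. c \<alpha> \<noteq> 0"
  proof (rule ccontr)
    assume "\<not> (\<exists>\<alpha>\<in>\<Delta>. c \<alpha> \<noteq> 0)"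
    then have "\<beta> = 0" using c by simp
    then show False using assms(1) pos_root zero_notin_roots by blast
  qed
  then obtain \<alpha> where "\<alpha> \<in> \<Delta>" "c \<alpha> \<noteq> 0" by blast
  then have "0 < (\<Sum>\<alpha>\<in>\<Delta>. real (c \<alpha>) * (g \<bullet> \<alpha>))"
    using assms(2) finite_simple by (intro sum_pos2[of _ \<alpha>]) (auto simp: less_imp_le)
  then show ?thesis unfolding c by (simp add: inner_sum_right)
qed

lemma pos_inner_nonneg:
  assumes "pos \<beta>" "\<And>\<alpha>. \<alpha> \<in> \<Delta> \<Longrightarrow> 0 \<le> g \<bullet> \<alpha>"
  shows "0 \<le> g \<bullet> \<beta>"
proof -
  obtain c :: "'a \<Rightarrow> nat" where c: "\<beta> = (\<Sum>\<alpha>\<in>\<Delta>. real (c \<alpha>) *\<^sub>R \<alpha>)"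
    using assms by (auto simp: pos_def)
  show ?thesis unfolding c using assms(2) by (auto simp: inner_sum_right intro!: sum_nonneg)
qed

lemma rho_inner_simple:
  assumes "\<alpha> \<in> \<Delta>"
  shows "rho \<Delta> J \<bullet> \<alpha> = (if \<alpha> \<in> J then 0 else (\<alpha> \<bullet> \<alpha>) / 2)"
proof -
  have \<alpha>0: "\<alpha> \<bullet> \<alpha> \<noteq> 0" using assms simple_root zero_notin_roots by auto
  have "fundamental_weight \<Delta> \<delta> \<bullet> \<alpha> = (if \<delta> = \<alpha> then (\<alpha> \<bullet> \<alpha>) / 2 else 0)" for \<delta>
  proof -
    have "cartan_pairing (fundamental_weight \<Delta> \<delta>) \<alpha> = (if \<alpha> = \<delta> then 1 else 0)"
      using theI'[OF fundamental_weight_ex1[OF independent_simple, of \<delta>]] assms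
      unfolding fundamental_weight_def by blast
    then show ?thesis using \<alpha>0 by (auto simp: cartan_pairing_def split: if_splits)
  qed
  then have "rho \<Delta> J \<bullet> \<alpha> = (\<Sum>\<delta>\<in>\<Delta> - J. if \<delta> = \<alpha> then (\<alpha> \<bullet> \<alpha>) / 2 else 0)"
    by (simp add: rho_def inner_sum_left)
  then show ?thesis using assms finite_simple by simp
qed

lemma rho_dominant: "pos \<beta> \<Longrightarrow> 0 \<le> rho \<Delta> J \<bullet> \<beta>"
  by (rule pos_inner_nonneg) (auto simp: rho_inner_simple)

lemma rho_regular: "pos \<beta> \<Longrightarrow> 0 < rho \<Delta> {} \<bullet> \<beta>"
  by (rule pos_inner) (use simple_root zero_notin_roots in \<open>force simp: rho_inner_simple\<close>)+

section \<open>Galleries\<close>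

text \<open>A gallery ascends from \<open>w\<close> in the left weak order.  A step from \<open>w\<close> to \<open>s\<^sub>\<alpha> w\<close> makes exactly one
  further positive root an inversion, namely \<open>w\<^sup>-\<^sup>1 \<alpha>\<close>, and this root is its label.  The labels of a
  gallery from the identity to the longest element are all positive roots in a reflection order.\<close>

inductive gallery :: "('a \<Rightarrow> 'a) \<Rightarrow> 'a list \<Rightarrow> ('a \<Rightarrow> 'a) \<Rightarrow> bool" where
  Nil: "gallery w [] w"
| Cons: "\<lbrakk>\<alpha> \<in> \<Delta>; pos (inv w \<alpha>); gallery (refl \<alpha> \<circ> w) L w'\<rbrakk> \<Longrightarrow> gallery w (inv w \<alpha> # L) w'"

lemma gallery_end_in_W: "gallery w L w' \<Longrightarrow> w \<in> W \<Longrightarrow> w' \<in> W"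
  by (induction rule: gallery.induct) (auto simp: comp_in_W simple_refl_in_W)

lemma gallery_step_positive:
  assumes w: "w \<in> W" and \<alpha>: "\<alpha> \<in> \<Delta>" "pos (inv w \<alpha>)" and \<gamma>: "pos \<gamma>"
  shows "pos ((refl \<alpha> \<circ> w) \<gamma>) \<longleftrightarrow> pos (w \<gamma>) \<and> \<gamma> \<noteq> inv w \<alpha>"
proof -
  have \<alpha>0: "\<alpha> \<noteq> 0" using \<alpha>(1) simple_root zero_notin_roots by blast
  consider "w \<gamma> = \<alpha>" | "w \<gamma> = - \<alpha>" | "w \<gamma> \<noteq> \<alpha>" "w \<gamma> \<noteq> - \<alpha>" by blast
  then show ?thesis
  proof cases
    case 1
    then have "\<gamma> = inv w \<alpha>" using w by (metis W_inv_f)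
    then show ?thesis
      using 1 root_reflection_self[OF \<alpha>0] pos_simple[OF \<alpha>(1)] not_pos_and_neg by auto
  next
    case 2
    then have "\<gamma> = - inv w \<alpha>" using w W_minus[OF inv_in_W] by (metis W_inv_f)
    then have False using \<gamma> not_pos_and_neg[OF \<alpha>(2)] by simp
    then show ?thesis ..
  next
    case 3
    then have "\<gamma> \<noteq> inv w \<alpha>" using w by auto
    then show ?thesis
      using pos_refl_simple_iff[OF \<alpha>(1) W_root[OF w pos_root[OF \<gamma>]] 3] by simp
  qed
qed

text \<open>Each step diminishes the set of positive roots that stay positive, so a gallery with labels in a
  prescribed set \<open>S\<close> can be prolonged until all the available labels lie outside of \<open>S\<close>.\<close>

lemma ex_maximal_gallery:
  assumes "w \<in> W"
  shows "\<exists>L w'. gallery w L w' \<and> (\<forall>\<gamma>\<in>set L. pos \<gamma> \<and> pos (w \<gamma>) \<and> \<gamma> \<in> S) \<and>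
    (\<forall>\<gamma>. pos \<gamma> \<longrightarrow> (pos (w' \<gamma>) \<longleftrightarrow> pos (w \<gamma>) \<and> \<gamma> \<notin> set L)) \<and>
    (\<forall>\<alpha>\<in>\<Delta>. pos (inv w' \<alpha>) \<longrightarrow> inv w' \<alpha> \<notin> S)"
  using assms
proof (induction "card {\<gamma>. pos \<gamma> \<and> pos (w \<gamma>)}" arbitrary: w rule: less_induct)
  case less
  show ?case
  proof (cases "\<exists>\<alpha>\<in>\<Delta>. pos (inv w \<alpha>) \<and> inv w \<alpha> \<in> S")
    case False
    then show ?thesis by (intro exI[of _ "[]"] exI[of _ w]) (auto intro: gallery.Nil)
  next
    case True
    then obtain \<alpha> where \<alpha>: "\<alpha> \<in> \<Delta>" "pos (inv w \<alpha>)" "inv w \<alpha> \<in> S" by blast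
    let ?w = "refl \<alpha> \<circ> w"
    have W: "?w \<in> W" using less.prems \<alpha>(1) comp_in_W simple_refl_in_W by blast
    note step = gallery_step_positive[OF less.prems \<alpha>(1,2)]
    have "{\<gamma>. pos \<gamma> \<and> pos (?w \<gamma>)} \<subset> {\<gamma>. pos \<gamma> \<and> pos (w \<gamma>)}"
      using step \<alpha> less.prems pos_simple by fastforce
    moreover have "finite {\<gamma>. pos \<gamma> \<and> pos (w \<gamma>)}"
      using finite_roots pos_root by (auto intro: finite_subset)
    ultimately have "card {\<gamma>. pos \<gamma> \<and> pos (?w \<gamma>)} < card {\<gamma>. pos \<gamma> \<and> pos (w \<gamma>)}"
      by (rule psubset_card_mono[rotated])
    then obtain L w' where L: "gallery ?w L w'" "\<forall>\<gamma>\<in>set L. pos \<gamma> \<and> pos (?w \<gamma>) \<and> \<gamma> \<in> S"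
      "\<forall>\<gamma>. pos \<gamma> \<longrightarrow> (pos (w' \<gamma>) \<longleftrightarrow> pos (?w \<gamma>) \<and> \<gamma> \<notin> set L)"
      "\<forall>\<alpha>\<in>\<Delta>. pos (inv w' \<alpha>) \<longrightarrow> inv w' \<alpha> \<notin> S"
      using less.hyps W by blast
    show ?thesis
    proof (intro exI conjI)
      show "gallery w (inv w \<alpha> # L) w'" using gallery.Cons \<alpha> L(1) by blast
      show "\<forall>\<gamma>. pos \<gamma> \<longrightarrow> (pos (w' \<gamma>) \<longleftrightarrow> pos (w \<gamma>) \<and> \<gamma> \<notin> set (inv w \<alpha> # L))"
        using L(3) step by auto
      show "\<forall>\<gamma>\<in>set (inv w \<alpha> # L). pos \<gamma> \<and> pos (w \<gamma>) \<and> \<gamma> \<in> S"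
        using L(2) step \<alpha> less.prems pos_simple by auto
      show "\<forall>\<alpha>\<in>\<Delta>. pos (inv w' \<alpha>) \<longrightarrow> inv w' \<alpha> \<notin> S" by (fact L(4))
    qed
  qed
qed

text \<open>If no step leads on from \<open>t\<close>, then \<open>t\<^sup>-\<^sup>1\<close> sends all simple roots to negative roots, so \<open>- t \<rho>\<close> is
  strictly dominant, where \<open>\<rho>\<close> is the sum of the fundamental weights.  Pairing it with \<open>t \<gamma>\<close> shows that
  no positive root \<open>\<gamma>\<close> stays positive.\<close>

lemma gallery_to_longest:
  assumes "w \<in> W"
  obtains L t where "gallery w L t" "t \<in> W" "\<forall>\<gamma>\<in>set L. pos \<gamma> \<and> pos (w \<gamma>)"
    "\<forall>\<gamma>. pos \<gamma> \<longrightarrow> \<not> pos (t \<gamma>)"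
proof -
  obtain L t where L: "gallery w L t" "\<forall>\<gamma>\<in>set L. pos \<gamma> \<and> pos (w \<gamma>) \<and> \<gamma> \<in> UNIV"
    and max: "\<forall>\<alpha>\<in>\<Delta>. pos (inv t \<alpha>) \<longrightarrow> inv t \<alpha> \<notin> UNIV"
    using ex_maximal_gallery[OF assms, of UNIV] by blast
  have t: "t \<in> W" using gallery_end_in_W L(1) assms by blast
  have "\<not> pos (t \<gamma>)" if "pos \<gamma>" for \<gamma>
  proof
    assume "pos (t \<gamma>)"
    moreover have "0 < - t (rho \<Delta> {}) \<bullet> \<alpha>" if \<alpha>: "\<alpha> \<in> \<Delta>" for \<alpha>
    proof -
      have "pos (- inv t \<alpha>)"
        using pos_uminus W_root[OF inv_in_W[OF t] simple_root[OF \<alpha>]] max \<alpha> by blast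
      then show ?thesis using rho_regular by (fastforce simp: W_inner_left[OF t])
    qed
    ultimately have "0 < - t (rho \<Delta> {}) \<bullet> t \<gamma>" by (rule pos_inner)
    then show False using rho_regular[OF that] by (simp add: W_inner[OF t])
  qed
  then show thesis using that L t by blast
qed

text \<open>Every positive root becomes negative under the longest element, so the exchange property
  applies to every reflection.\<close>

lemma refl_in_W:
  assumes "\<gamma> \<in> \<Phi>" shows "refl \<gamma> \<in> W"
proof -
  obtain L t where "gallery id L t" and t: "t \<in> W"
    and "\<forall>\<gamma>\<in>set L. pos \<gamma> \<and> pos (id \<gamma>)" and top: "\<forall>\<gamma>. pos \<gamma> \<longrightarrow> \<not> pos (t \<gamma>)"
    using gallery_to_longest[OF id_in_W] .
  have "refl \<gamma> \<in> W" if "pos \<gamma>" for \<gamma>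
  proof -
    have "\<not> pos (inv t \<gamma>)" using t top that by (metis W_f_inv)
    then have "(refl \<gamma> \<circ> t) \<circ> inv t \<in> W"
      using refl_descent(1)[OF t that] comp_in_W inv_in_W t by blast
    then show ?thesis using t by (simp add: comp_assoc)
  qed
  then show ?thesis using pos_or_neg[OF assms] by fastforce
qed

section \<open>Bruhat order and the lifting property\<close>

lemma len_reflection_iff:
  assumes x: "x \<in> W" and \<gamma>: "pos \<gamma>"
  shows "len x < len (refl \<gamma> \<circ> x) \<longleftrightarrow> pos (inv x \<gamma>)"
proof (cases "pos (inv x \<gamma>)")
  case True
  have root: "\<gamma> \<in> \<Phi>" using \<gamma> pos_root by blast
  have "inv (refl \<gamma> \<circ> x) \<gamma> = - inv x \<gamma>"
    using inv_refl_comp[OF x root] W_minus[OF inv_in_W[OF x]] refl_self_root[OF root]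
    by simp
  then have "\<not> pos (inv (refl \<gamma> \<circ> x) \<gamma>)" using True not_pos_and_neg[OF True] by auto
  from refl_descent(2)[OF comp_in_W[OF refl_in_W[OF root] x] \<gamma> this] True
  show ?thesis by simp
next
  case False
  then show ?thesis using refl_descent(2)[OF x \<gamma> False] by simp
qed

lemma simple_right_pos:
  assumes x: "x \<in> W" and r: "r \<in> \<Delta>"
  shows "pos ((x \<circ> refl r) r) \<longleftrightarrow> \<not> pos (x r)"
proof -
  have "(x \<circ> refl r) r = - x r"
    using refl_self_root[OF simple_root[OF r]] W_minus[OF x] by simp
  then show ?thesis using pos_uminus[OF W_root[OF x simple_root[OF r]]] by simp
qed

lemma len_simple_right_le:
  assumes x: "x \<in> W" and r: "r \<in> \<Delta>" shows "len (x \<circ> refl r) \<le> len x + 1"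
proof -
  obtain as where as: "as \<in> lists \<Delta>" "word_map as = x" "length as = len x"
    using reduced_word x by blast
  have "word_map (as @ [r]) = x \<circ> refl r" using as(2) by (simp add: word_map_append)
  moreover have "as @ [r] \<in> lists \<Delta>" using as(1) r by simp
  ultimately show ?thesis using len_word_le[of "as @ [r]"] as(3) by simp
qed

lemma len_simple_right:
  assumes x: "x \<in> W" and r: "r \<in> \<Delta>" and "pos (x r)"
  shows "len (x \<circ> refl r) = len x + 1"
proof -
  have "len x < len (x \<circ> refl r)"
    using len_reflection_iff[OF x assms(3)] x pos_simple[OF r] by (simp add: W_refl)
  then show ?thesis using len_simple_right_le[OF x r] by simp
qed

lemma len_simple_right_neg:
  assumes x: "x \<in> W" and r: "r \<in> \<Delta>" and "\<not> pos (x r)"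
  shows "len x = len (x \<circ> refl r) + 1"
  using len_simple_right[OF comp_in_W[OF x simple_refl_in_W[OF r]] r] simple_right_pos[OF x r]
    assms(3) by (simp add: comp_assoc)

lemma bruhat_step_iff:
  assumes x: "x \<in> W"
  shows "bruhat_step \<Phi> \<Delta> x y \<longleftrightarrow> (\<exists>\<gamma>. pos \<gamma> \<and> pos (inv x \<gamma>) \<and> y = refl \<gamma> \<circ> x)"
proof
  assume "bruhat_step \<Phi> \<Delta> x y"
  then obtain \<beta> where \<beta>: "\<beta> \<in> \<Phi>" "y = x \<circ> refl \<beta>" "len x < len y"
    by (auto simp: bruhat_step_def)
  obtain \<gamma> where \<gamma>: "pos \<gamma>" "\<gamma> = x \<beta> \<or> \<gamma> = - x \<beta>"
    using pos_or_neg[OF W_root[OF x \<beta>(1)]] by blast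
  then have "y = refl \<gamma> \<circ> x" using \<beta>(2) W_refl[OF x] by auto
  then show "\<exists>\<gamma>. pos \<gamma> \<and> pos (inv x \<gamma>) \<and> y = refl \<gamma> \<circ> x"
    using \<gamma>(1) \<beta>(3) len_reflection_iff[OF x \<gamma>(1)] by auto
next
  assume "\<exists>\<gamma>. pos \<gamma> \<and> pos (inv x \<gamma>) \<and> y = refl \<gamma> \<circ> x"
  then obtain \<gamma> where \<gamma>: "pos \<gamma>" "pos (inv x \<gamma>)" "y = refl \<gamma> \<circ> x" by blast
  then show "bruhat_step \<Phi> \<Delta> x y"
    unfolding bruhat_step_def
    using len_reflection_iff[OF x \<gamma>(1)] pos_root[OF \<gamma>(2)] W_refl_left[OF x] by auto
qed

lemma bruhat_step_in_W:
  assumes "x \<in> W" "bruhat_step \<Phi> \<Delta> x y" shows "y \<in> W"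
  using assms bruhat_step_iff comp_in_W refl_in_W pos_root by metis

lemma le_in_W: "le x y \<Longrightarrow> x \<in> W" "le x y \<Longrightarrow> y \<in> W"
  by (auto simp: bruhat_le_def)

lemma le_refl: "x \<in> W \<Longrightarrow> le x x"
  by (simp add: bruhat_le_def)

lemma le_trans: "\<lbrakk>le x y; le y z\<rbrakk> \<Longrightarrow> le x z"
  by (auto simp: bruhat_le_def)

lemma step_le: "\<lbrakk>x \<in> W; bruhat_step \<Phi> \<Delta> x y\<rbrakk> \<Longrightarrow> le x y"
  using bruhat_step_in_W by (auto simp: bruhat_le_def)

lemma reflection_le:
  assumes "x \<in> W" "pos \<gamma>" "pos (inv x \<gamma>)" shows "le x (refl \<gamma> \<circ> x)"
  using assms bruhat_step_iff step_le by blast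

lemma le_len:
  assumes "le x y" shows "len x < len y \<or> x = y"
proof -
  have "(bruhat_step \<Phi> \<Delta>)\<^sup>*\<^sup>* x y" using assms by (simp add: bruhat_le_def)
  then show ?thesis by induction (auto simp: bruhat_step_def)
qed

lemma le_simple_right:
  assumes x: "x \<in> W" and r: "r \<in> \<Delta>" and "pos (x r)"
  shows "le x (x \<circ> refl r)"
  using reflection_le[OF x assms(3)] x pos_simple[OF r] by (simp add: W_refl)

definition lower :: "'a \<Rightarrow> ('a \<Rightarrow> 'a) \<Rightarrow> 'a \<Rightarrow> 'a" where
  "lower r x = (if pos (x r) then x else x \<circ> refl r)"

definition upper :: "'a \<Rightarrow> ('a \<Rightarrow> 'a) \<Rightarrow> 'a \<Rightarrow> 'a" where
  "upper r x = (if pos (x r) then x \<circ> refl r else x)"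

lemma lower_le_upper:
  assumes x: "x \<in> W" and r: "r \<in> \<Delta>"
  shows "le (lower r x) x" "le (lower r x) (x \<circ> refl r)" "le x (upper r x)"
    "le (x \<circ> refl r) (upper r x)"
proof -
  have W: "x \<circ> refl r \<in> W" using x r comp_in_W simple_refl_in_W by blast
  have "le x (x \<circ> refl r)" if "pos (x r)" using le_simple_right[OF x r that] .
  moreover have "le (x \<circ> refl r) x" if "\<not> pos (x r)"
    using le_simple_right[OF W r] simple_right_pos[OF x r] that by (simp add: comp_assoc)
  ultimately show "le (lower r x) x" "le (lower r x) (x \<circ> refl r)" "le x (upper r x)"
    "le (x \<circ> refl r) (upper r x)"
    using x W le_refl by (auto simp: lower_def upper_def)
qed

text \<open>Right multiplication by \<open>r\<close> keeps the left reflection of a Bruhat step, and it also keeps the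
  direction of the step unless the step is itself the multiplication by \<open>r\<close>.\<close>

lemma step_lifting:
  assumes x: "x \<in> W" and r: "r \<in> \<Delta>" and step: "bruhat_step \<Phi> \<Delta> x y"
  shows "le (lower r x) (lower r y) \<and> le (upper r x) (upper r y)"
proof -
  obtain \<gamma> where \<gamma>: "pos \<gamma>" "pos (inv x \<gamma>)" "y = refl \<gamma> \<circ> x"
    using step bruhat_step_iff[OF x] by blast
  have y: "y \<in> W" using bruhat_step_in_W x step by blast
  have xr: "x \<circ> refl r \<in> W" using x r comp_in_W simple_refl_in_W by blast
  show ?thesis
  proof (cases "inv x \<gamma> = r")
    case True
    then have "y = x \<circ> refl r" using \<gamma>(3) W_refl_left[OF x] by simp
    then have "lower r y = lower r x" "upper r y = upper r x"
      using simple_right_pos[OF x r] by (auto simp: lower_def upper_def comp_assoc)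
    then show ?thesis
      using lower_le_upper[OF x r] le_in_W le_refl by metis
  next
    case False
    have "inv (x \<circ> refl r) \<gamma> = refl r (inv x \<gamma>)"
    proof -
      have "x \<circ> refl r \<circ> (refl r \<circ> inv x) = id" "refl r \<circ> inv x \<circ> (x \<circ> refl r) = id"
        using x by (auto simp: fun_eq_iff)
      then have "inv (x \<circ> refl r) = refl r \<circ> inv x" by (rule inv_unique_comp)
      then show ?thesis by simp
    qed
    then have "pos (inv (x \<circ> refl r) \<gamma>)" using pos_refl_simple[OF r \<gamma>(2) False] by simp
    then have right: "le (x \<circ> refl r) (y \<circ> refl r)"
      using reflection_le[OF xr \<gamma>(1)] \<gamma>(3) by (simp add: comp_assoc)
    have left: "le x y" using step_le x step .
    note lx = lower_le_upper[OF x r] and ly = lower_le_upper[OF y r]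
    have "le (lower r x) (lower r y)"
      using le_trans[OF lx(1) left] le_trans[OF lx(2) right] by (simp add: lower_def[of r y])
    moreover have "le (upper r x) (upper r y)"
      using le_trans[OF left ly(3)] le_trans[OF right ly(4)] by (simp add: upper_def[of r x])
    ultimately show ?thesis ..
  qed
qed

lemma lifting:
  assumes "le x y" and r: "r \<in> \<Delta>"
  shows "le (lower r x) (lower r y)" "le (upper r x) (upper r y)"
proof -
  have x: "x \<in> W" and "(bruhat_step \<Phi> \<Delta>)\<^sup>*\<^sup>* x y" using assms by (auto simp: bruhat_le_def)
  from this(2) have "y \<in> W \<and> le (lower r x) (lower r y) \<and> le (upper r x) (upper r y)"
  proof induction
    case base
    then show ?case using x le_refl lower_le_upper[OF x r] le_in_W by metis
  next
    case (step y z)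
    then show ?case using step_lifting r bruhat_step_in_W le_trans by blast
  qed
  then show "le (lower r x) (lower r y)" "le (upper r x) (upper r y)" by auto
qed

text \<open>Comparison with an element \<open>z r\<close> below \<open>z\<close> reduces to comparison with \<open>z\<close>.  These two equivalences
  match the two cases of the recursion for path counts.\<close>

lemma le_iff_of_descent:
  assumes z: "z \<in> W" "\<not> pos (z r)" and v: "v \<in> W" "\<not> pos (v r)" and r: "r \<in> \<Delta>"
  shows "le (z \<circ> refl r) v \<longleftrightarrow> le z v"
proof
  have zr: "pos ((z \<circ> refl r) r)" using simple_right_pos[OF z(1) r] z(2) by blast
  show "le z v" if "le (z \<circ> refl r) v"
    using lifting(2)[OF that r] zr v(2) by (simp add: upper_def comp_assoc)
  show "le (z \<circ> refl r) v" if "le z v"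
    using lower_le_upper(1)[OF z(1) r] le_trans that z(2) by (auto simp: lower_def)
qed

lemma le_iff_of_ascent:
  assumes z: "z \<in> W" "\<not> pos (z r)" and v: "v \<in> W" "pos (v r)" and r: "r \<in> \<Delta>"
  shows "le (z \<circ> refl r) v \<longleftrightarrow> le z (v \<circ> refl r)"
proof
  have zr: "pos ((z \<circ> refl r) r)" using simple_right_pos[OF z(1) r] z(2) by blast
  have vr: "\<not> pos ((v \<circ> refl r) r)" using simple_right_pos[OF v(1) r] v(2) by blast
  show "le z (v \<circ> refl r)" if "le (z \<circ> refl r) v"
    using lifting(2)[OF that r] zr v(2) by (simp add: upper_def comp_assoc)
  show "le (z \<circ> refl r) v" if "le z (v \<circ> refl r)"
    using lifting(1)[OF that r] z(2) vr by (simp add: lower_def comp_assoc)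
qed

section \<open>Counting label-monotone paths\<close>

text \<open>A function \<open>\<phi>\<close> on \<open>W\<close> stands for the formal combination of the elements \<open>z\<close> with coefficients \<open>\<phi> z\<close>.
  The operator \<open>arrow \<gamma>\<close> adds to each \<open>z\<close> with an upward \<open>\<gamma>\<close>-edge the other end \<open>s\<^sub>\<gamma> z\<close> of this edge,
  weighted by the indeterminate \<open>q\<close>.  Hence \<open>fold arrow L\<close> applied to \<open>u\<close> is the sum over all upward
  paths in the Bruhat graph that start at \<open>u\<close> and whose labels form a subsequence of \<open>L\<close>, and the
  exponent of \<open>q\<close> is the number of edges.\<close>

definition arrow :: "'a \<Rightarrow> (('a \<Rightarrow> 'a) \<Rightarrow> nat poly) \<Rightarrow> ('a \<Rightarrow> 'a) \<Rightarrow> nat poly" where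
  "arrow \<gamma> \<phi> z = \<phi> z + (if pos (inv z \<gamma>) then 0 else pCons 0 (\<phi> (refl \<gamma> \<circ> z)))"

text \<open>For \<open>w = id\<close> this is the right action of a Hecke algebra generator with quadratic relation
  \<open>T\<^sup>2 = 1 + q T\<close>, which sends \<open>z\<close> to \<open>z r + q z\<close> if \<open>z r\<close> is longer than \<open>z\<close> and to \<open>z r\<close> otherwise.  In
  general the comparison of \<open>z\<close> with \<open>z r\<close> is replaced by that of \<open>w z\<close> with \<open>w z r\<close>.\<close>

definition hecke :: "('a \<Rightarrow> 'a) \<Rightarrow> 'a \<Rightarrow> (('a \<Rightarrow> 'a) \<Rightarrow> nat poly) \<Rightarrow> ('a \<Rightarrow> 'a) \<Rightarrow> nat poly" where
  "hecke w r \<phi> z = \<phi> (z \<circ> refl r) + (if pos (w (z r)) then pCons 0 (\<phi> z) else 0)"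

definition delta :: "('a \<Rightarrow> 'a) \<Rightarrow> ('a \<Rightarrow> 'a) \<Rightarrow> nat poly" where
  "delta u z = (if z = u then 1 else 0)"

text \<open>One step of a gallery changes the twist from \<open>w\<close> to \<open>s\<^sub>\<alpha> w\<close>, which matters only at those \<open>z\<close> where the
  edge between \<open>z\<close> and \<open>z r\<close> is also the edge with label \<open>w\<^sup>-\<^sup>1 \<alpha>\<close>.  At such a \<open>z\<close> the term
  that \<open>arrow\<close> contributes replaces the one that the change of twist creates or destroys.  At every other
  \<open>z\<close> no sign changes and the two operations commute.\<close>

lemma arrow_hecke:
  assumes w: "w \<in> W" and \<alpha>: "\<alpha> \<in> \<Delta>" and r: "r \<in> \<Delta>" and z: "z \<in> W"
  shows "arrow (inv w \<alpha>) (hecke w r \<phi>) z = hecke (refl \<alpha> \<circ> w) r (arrow (inv w \<alpha>) \<phi>) z"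
proof -
  define \<gamma> where "\<gamma> = inv w \<alpha>"
  have w\<gamma>: "w \<gamma> = \<alpha>" using w by (simp add: \<gamma>_def)
  have \<gamma>: "\<gamma> \<in> \<Phi>" using W_root[OF inv_in_W[OF w] simple_root[OF \<alpha>]] by (simp add: \<gamma>_def)
  have ws: "w (refl \<gamma> x) = refl \<alpha> (w x)" for x
    using W_refl[OF w, of \<gamma>] w\<gamma> by (simp add: fun_eq_iff)
  have inv_zr: "inv (z \<circ> refl r) = refl r \<circ> inv z"
  proof (rule inv_unique_comp)
    show "z \<circ> refl r \<circ> (refl r \<circ> inv z) = id" "refl r \<circ> inv z \<circ> (z \<circ> refl r) = id"
      using z by (auto simp: fun_eq_iff)
  qed
  have \<alpha>0: "refl \<alpha> \<alpha> = - \<alpha>" "refl \<alpha> (- \<alpha>) = \<alpha>" and r0: "refl r r = - r" "refl r (- r) = r"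
    using refl_self_root[OF simple_root[OF \<alpha>]] refl_self_root[OF simple_root[OF r]]
      root_reflection_invol[of \<alpha> \<alpha>] root_reflection_invol[of r r] by simp_all
  have p: "pos \<alpha>" "\<not> pos (- \<alpha>)" "pos r" "\<not> pos (- r)"
    using pos_simple \<alpha> r not_pos_and_neg by blast+
  \<comment> \<open>In the first two cases the \<open>\<gamma>\<close>-edge at \<open>z\<close> is the edge between \<open>z\<close> and \<open>z r\<close>.\<close>
  consider "w (z r) = \<alpha>" | "w (z r) = - \<alpha>" | "w (z r) \<noteq> \<alpha>" "w (z r) \<noteq> - \<alpha>" by blast
  then have "arrow \<gamma> (hecke w r \<phi>) z = hecke (refl \<alpha> \<circ> w) r (arrow \<gamma> \<phi>) z"
  proof cases
    case 1
    then have "z r = \<gamma>" using w by (metis W_inv_f \<gamma>_def)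
    then have *: "inv z \<gamma> = r" and **: "refl \<gamma> \<circ> z = z \<circ> refl r"
      using z W_refl[OF z, of r] by auto
    have "refl \<gamma> \<circ> (z \<circ> refl r) = z" using ** by (metis comp_assoc root_reflection_comp_self comp_id)
    then show ?thesis
      using 1 * p \<alpha>0 r0 by (simp add: arrow_def hecke_def inv_zr)
  next
    case 2
    then have "w (- z r) = \<alpha>" using W_minus[OF w] by simp
    then have zr: "z r = - \<gamma>" using w by (metis W_inv_f \<gamma>_def minus_minus)
    then have "z (- r) = \<gamma>" using W_minus[OF z] by simp
    then have *: "inv z \<gamma> = - r" using z by (metis W_inv_f)
    have **: "refl \<gamma> \<circ> z = z \<circ> refl r"
      using W_refl[OF z, of r] zr by simp
    have "refl \<gamma> \<circ> (z \<circ> refl r) = z" using ** by (metis comp_assoc root_reflection_comp_self comp_id)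
    moreover have "refl \<gamma> (z r) = \<gamma>" 
      using zr refl_self_root[OF \<gamma>] root_reflection_invol[of \<gamma> \<gamma>] by simp
    moreover have "w (z (- r)) = \<alpha>" using 2 W_minus[OF z] W_minus[OF w] by simp
    ultimately show ?thesis
      using 2 * ** p \<alpha>0 r0 w\<gamma> by (simp add: arrow_def hecke_def inv_zr comp_assoc add_ac)
  next
    case 3
    have zr\<Phi>: "w (z r) \<in> \<Phi>" using W_root w z simple_root r by blast
    have pw: "pos (refl \<alpha> (w (z r))) \<longleftrightarrow> pos (w (z r))"
      using pos_refl_simple_iff[OF \<alpha> zr\<Phi> 3] .
    have "inv z \<gamma> \<noteq> r"
      using 3(1) w\<gamma> z by auto
    moreover have "inv z \<gamma> \<noteq> - r"
    proof
      assume "inv z \<gamma> = - r"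
      then have "\<gamma> = - z r" using W_minus[OF z] W_f_inv[OF z] by metis
      then have "- w (z r) = \<alpha>" using w\<gamma> W_minus[OF w] by simp
      then show False using 3(2) by auto
    qed
    ultimately have pz: "pos (refl r (inv z \<gamma>)) \<longleftrightarrow> pos (inv z \<gamma>)"
      using pos_refl_simple_iff[OF r W_root[OF inv_in_W[OF z] \<gamma>]] by blast
    show ?thesis
      using pw pz by (simp add: arrow_def hecke_def inv_zr ws comp_assoc add_ac)
  qed
  then show ?thesis by (simp add: \<gamma>_def)
qed

lemma arrow_in_W_cong:
  assumes "\<And>z. z \<in> W \<Longrightarrow> \<phi> z = \<psi> z" "\<gamma> \<in> \<Phi>" "z \<in> W"
  shows "arrow \<gamma> \<phi> z = arrow \<gamma> \<psi> z"
  using assms comp_in_W refl_in_W by (simp add: arrow_def)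

lemma fold_arrow_cong:
  assumes "set L \<subseteq> \<Phi>" "\<And>z. z \<in> W \<Longrightarrow> \<phi> z = \<psi> z" "z \<in> W"
  shows "fold arrow L \<phi> z = fold arrow L \<psi> z"
  using assms
proof (induction L arbitrary: \<phi> \<psi> z)
  case (Cons \<gamma> L)
  have "fold arrow L (arrow \<gamma> \<phi>) z = fold arrow L (arrow \<gamma> \<psi>) z"
  proof (rule Cons.IH[of "arrow \<gamma> \<phi>" "arrow \<gamma> \<psi>" z])
    show "arrow \<gamma> \<phi> z = arrow \<gamma> \<psi> z" if "z \<in> W" for z
      using arrow_in_W_cong[of \<phi> \<psi> \<gamma> z] Cons.prems(1,2) that by simp
  qed (use Cons.prems in auto)
  then show ?case by simp
qed simp

lemma gallery_labels: "gallery w L w' \<Longrightarrow> \<gamma> \<in> set L \<Longrightarrow> pos \<gamma>"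
  by (induction rule: gallery.induct) auto

lemma gallery_hecke:
  assumes "gallery w L w'" "w \<in> W" "r \<in> \<Delta>" "z \<in> W"
  shows "fold arrow L (hecke w r \<phi>) z = hecke w' r (fold arrow L \<phi>) z"
  using assms
proof (induction arbitrary: \<phi> z rule: gallery.induct)
  case (Nil w)
  then show ?case by simp
next
  case (Cons \<alpha> w L w')
  have w: "refl \<alpha> \<circ> w \<in> W" using Cons comp_in_W simple_refl_in_W by blast
  have "set L \<subseteq> \<Phi>" using gallery_labels[OF Cons.hyps(3)] pos_root by blast
  then have "fold arrow L (arrow (inv w \<alpha>) (hecke w r \<phi>)) z =
      fold arrow L (hecke (refl \<alpha> \<circ> w) r (arrow (inv w \<alpha>) \<phi>)) z"
    using arrow_hecke Cons by (intro fold_arrow_cong) blast+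
  then show ?case using Cons.IH[OF w] Cons.prems by simp
qed

lemma hecke_delta:
  assumes z: "z \<in> W" "\<not> pos (z r)"
  shows "hecke id r (delta z) x = delta (z \<circ> refl r) x"
proof -
  have "x \<circ> refl r = z \<longleftrightarrow> x = z \<circ> refl r" by (auto simp: comp_assoc)
  then show ?thesis using z by (auto simp: hecke_def delta_def)
qed

lemma arrow_delta_top:
  assumes u: "u \<in> W" and \<gamma>: "pos \<gamma>" "\<not> pos (inv u \<gamma>)"
  shows "arrow \<gamma> (delta u) z = delta u z"
proof -
  have "pos (inv z \<gamma>)" if "refl \<gamma> \<circ> z = u"
  proof -
    have "z = refl \<gamma> \<circ> u" using that by auto
    then have "inv z \<gamma> = - inv u \<gamma>"
      using inv_refl_comp[OF u pos_root[OF \<gamma>(1)]] refl_self_root[OF pos_root[OF \<gamma>(1)]]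
        W_minus[OF inv_in_W[OF u]] by simp
    then show ?thesis
      using pos_uminus[OF W_root[OF inv_in_W[OF u] pos_root[OF \<gamma>(1)]]] \<gamma>(2) by simp
  qed
  then show ?thesis by (auto simp: arrow_def delta_def)
qed

lemma fold_arrow_delta_top:
  assumes u: "u \<in> W" and top: "\<And>\<gamma>. pos \<gamma> \<Longrightarrow> \<not> pos (inv u \<gamma>)"
    and "\<And>\<gamma>. \<gamma> \<in> set L \<Longrightarrow> pos \<gamma>"
  shows "fold arrow L (delta u) = delta u"
  using assms(3)
proof (induction L)
  case (Cons \<gamma> L)
  then have "arrow \<gamma> (delta u) = delta u" using arrow_delta_top[OF u] top by auto
  then show ?case using Cons by simp
qed simp

lemma le_top:
  assumes u: "u \<in> W" and top: "\<And>\<gamma>. pos \<gamma> \<Longrightarrow> \<not> pos (inv u \<gamma>)" and "le u v"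
  shows "v = u"
proof -
  have "(bruhat_step \<Phi> \<Delta>)\<^sup>*\<^sup>* u v" using assms(3) by (simp add: bruhat_le_def)
  then show ?thesis
    by (cases rule: converse_rtranclpE) (use bruhat_step_iff[OF u] top in auto)
qed

lemma last_letter:
  assumes "y \<in> W" "len y \<noteq> 0"
  obtains x r where "x \<in> W" "r \<in> \<Delta>" "y = x \<circ> refl r" "len x < len y" "pos (x r)"
proof -
  obtain as where as: "as \<in> lists \<Delta>" "word_map as = y" "length as = len y"
    using reduced_word assms(1) by blast
  then obtain bs r where bs: "as = bs @ [r]" using assms(2) by (cases as rule: rev_cases) auto
  let ?x = "word_map bs"
  have r: "r \<in> \<Delta>" and x: "?x \<in> W" and y: "y = ?x \<circ> refl r" and l: "len ?x < len y"
    using as bs len_word_le[of bs] by (auto simp: weyl_group_def word_map_append)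
  have "pos (?x r)"
  proof (rule ccontr)
    assume "\<not> pos (?x r)"
    then show False using len_simple_right_neg[OF x r] y l by simp
  qed
  then show thesis using that x r y l by blast
qed

text \<open>The longest element \<open>t\<^sup>-\<^sup>1\<close> has no upward edges, so its only path is the trivial one.  From there the
  start \<open>u = t\<^sup>-\<^sup>1 y\<close> descends by right multiplications: if \<open>u = z r\<close> lies below \<open>z\<close>, then \<open>u\<close> is obtained from
  \<open>z\<close> by the untwisted Hecke operator, which turns into the one twisted by \<open>t\<close> after the whole gallery.
  Since \<open>t\<close> exchanges positive and negative roots, the path polynomials \<open>P\<close> satisfy
  \<open>P (z r, v) = P (z, v r)\<close> if \<open>v r\<close> is above \<open>v\<close>, and \<open>P (z r, v) = P (z, v r) + q P (z, v)\<close> otherwise.  In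
  the second case the first summand has too small a degree to matter.\<close>

lemma coeff_fold_arrow_longest:
  assumes gal: "gallery id L t" and t: "t \<in> W" "\<And>\<gamma>. pos \<gamma> \<Longrightarrow> \<not> pos (t \<gamma>)"
    and u: "u \<in> W" and v: "v \<in> W" and k: "len v \<le> k + len u"
  shows "coeff (fold arrow L (delta u) v) k = (if k + len u = len v \<and> le u v then 1 else 0)"
proof -
  have t_inv: "\<not> pos (inv t \<delta>)" if "pos \<delta>" for \<delta>
    using t that by (metis W_f_inv)
  have t_iff: "pos (t \<delta>) \<longleftrightarrow> \<not> pos \<delta>" if "\<delta> \<in> \<Phi>" for \<delta>
    using t that W_root[OF t(1) that] pos_or_neg[OF that] W_minus[OF t(1)] pos_uminus by metis
  have L: "\<And>\<gamma>. \<gamma> \<in> set L \<Longrightarrow> pos \<gamma>" "set L \<subseteq> \<Phi>" using gallery_labels[OF gal] pos_root by blast+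
  have "\<forall>v k. v \<in> W \<longrightarrow> len v \<le> k + len (inv t \<circ> y) \<longrightarrow>
      coeff (fold arrow L (delta (inv t \<circ> y)) v) k =
      (if k + len (inv t \<circ> y) = len v \<and> le (inv t \<circ> y) v then 1 else 0)" if "y \<in> W" for y
    using that
  proof (induction "len y" arbitrary: y rule: less_induct)
    case less
    show ?case
    proof (cases "len y = 0")
      case True
      then have "y = id" using reduced_word[OF less.prems] by (metis length_0_conv word_map_Nil)
      then have y: "inv t \<circ> y = inv t" by simp
      have top: "\<not> pos (inv (inv t) \<gamma>)" if "pos \<gamma>" for \<gamma>
        using t that by (simp add: W_inv_inv)
      have "le (inv t) v \<longleftrightarrow> v = inv t" for v
        using le_top[OF inv_in_W[OF t(1)] top] le_refl[OF inv_in_W[OF t(1)]] by blast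
      moreover have "fold arrow L (delta (inv t)) = delta (inv t)"
        using fold_arrow_delta_top[OF inv_in_W[OF t(1)] top L(1)] .
      ultimately show ?thesis unfolding y by (auto simp: delta_def)
    next
      case False
      then obtain x r where x: "x \<in> W" and r: "r \<in> \<Delta>" and y: "y = x \<circ> refl r"
        and lx: "len x < len y" and px: "pos (x r)"
        using last_letter less.prems by blast
      define z where "z = inv t \<circ> x"
      define F where "F = fold arrow L (delta z)"
      have z: "z \<in> W" unfolding z_def using x t(1) comp_in_W inv_in_W by blast
      have zr: "\<not> pos (z r)" using t_inv[OF px] by (simp add: z_def)
      have yz: "inv t \<circ> y = z \<circ> refl r" using y by (simp add: z_def comp_assoc)
      have lz: "len z = len (z \<circ> refl r) + 1" using len_simple_right_neg[OF z r zr] .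
      have IH: "coeff (F v) k = (if k + len z = len v \<and> le z v then 1 else 0)"
        if "v \<in> W" "len v \<le> k + len z" for v k
        using less.hyps[OF lx x] that by (simp add: F_def z_def)
      show ?thesis
      proof (intro allI impI)
        fix v k
        assume v: "v \<in> W" and k: "len v \<le> k + len (inv t \<circ> y)"
        have vr: "v \<circ> refl r \<in> W" using v r comp_in_W simple_refl_in_W by blast
        have ptv: "pos (t (v r)) \<longleftrightarrow> \<not> pos (v r)"
          using t_iff W_root[OF v simple_root[OF r]] by blast
        have "fold arrow L (delta (z \<circ> refl r)) v = fold arrow L (hecke id r (delta z)) v"
          using hecke_delta[OF z zr] by (intro fold_arrow_cong[OF L(2) _ v]) simp
        also have "\<dots> = hecke t r F v"
          unfolding F_def using gallery_hecke[OF gal id_in_W r v] .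
        finally have rec: "fold arrow L (delta (z \<circ> refl r)) v =
            F (v \<circ> refl r) + (if pos (v r) then 0 else pCons 0 (F v))"
          using ptv by (simp add: hecke_def)
        show "coeff (fold arrow L (delta (inv t \<circ> y)) v) k =
          (if k + len (inv t \<circ> y) = len v \<and> le (inv t \<circ> y) v then 1 else 0)"
        proof (cases "pos (v r)")
          case True
          have lv: "len (v \<circ> refl r) = len v + 1" using len_simple_right[OF v r True] .
          then have "coeff (F (v \<circ> refl r)) k =
              (if k + len z = len (v \<circ> refl r) \<and> le z (v \<circ> refl r) then 1 else 0)"
            using IH[OF vr] k lz yz by simp
          then show ?thesis
            using rec True lv lz yz le_iff_of_ascent[OF z zr v True r] by simp
        next
          case False
          have lv: "len v = len (v \<circ> refl r) + 1" using len_simple_right_neg[OF v r False] .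
          have le_iff: "le (z \<circ> refl r) v \<longleftrightarrow> le z v" using le_iff_of_descent[OF z zr v False r] .
          have "coeff (F (v \<circ> refl r)) k = 0" using IH[OF vr] k lz lv yz by simp
          moreover have "coeff (pCons 0 (F v)) k =
              (if k + len (z \<circ> refl r) = len v \<and> le z v then 1 else 0)"
          proof (cases k)
            \<comment> \<open>Here \<open>v\<close> would have the length of \<open>z r\<close>, so it is too short to lie above \<open>z\<close>.\<close>
            case 0
            then show ?thesis using le_len[of z v] lz by auto
          next
            case (Suc j)
            then show ?thesis using IH[OF v, of j] k lz yz by simp
          qed
          ultimately show ?thesis using rec False yz le_iff by simp
        qed
      qed
    qed
  qed
  from this[OF comp_in_W[OF t(1) u]] show ?thesis
    using v k t(1) by (simp flip: comp_assoc)
qed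

lemma pCons_0_sum: "pCons 0 (sum f A) = (\<Sum>i\<in>A. pCons 0 (f i))"
  using sum_comp_morphism[of "pCons 0" f A] by (simp add: o_def)

lemma fold_arrow_sum:
  assumes "set L \<subseteq> \<Phi>" "v \<in> W"
  shows "fold arrow L \<phi> v = (\<Sum>m\<in>W. \<phi> m * fold arrow L (delta m) v)"
  using assms
proof (induction L arbitrary: v rule: rev_induct)
  case Nil
  have "(\<Sum>m\<in>W. \<phi> m * delta m v) = (\<Sum>m\<in>W. if m = v then \<phi> m else 0)"
    by (rule sum.cong) (auto simp: delta_def)
  then show ?case using Nil finite_W by simp
next
  case (snoc \<gamma> L)
  have W: "refl \<gamma> \<circ> v \<in> W" using snoc.prems comp_in_W refl_in_W by simp
  have IH: "fold arrow L \<phi> x = (\<Sum>m\<in>W. \<phi> m * fold arrow L (delta m) x)" if "x \<in> W" for x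
    using snoc.IH[OF _ that] snoc.prems(1) by simp
  show ?case
    using IH[OF snoc.prems(2)] IH[OF W]
    by (simp add: arrow_def[of \<gamma> _ v] distrib_left sum.distrib pCons_0_sum)
qed

definition cover_step :: "'a set \<Rightarrow> ('a \<Rightarrow> 'a) \<Rightarrow> ('a \<Rightarrow> 'a) \<Rightarrow> bool" where
  "cover_step S x y \<longleftrightarrow> (\<exists>\<gamma>\<in>S. pos \<gamma> \<and> y = refl \<gamma> \<circ> x) \<and> len y = len x + 1"

text \<open>An edge of the Bruhat graph raises the length by at least one, so a path has at most
  \<open>\<ell>(v) - \<ell>(u)\<close> edges, and a path with that many edges consists of cover relations.\<close>

lemma coeff_fold_arrow:
  assumes "\<And>\<gamma>. \<gamma> \<in> set L \<Longrightarrow> pos \<gamma>" "u \<in> W" "v \<in> W"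
    and "coeff (fold arrow L (delta u) v) k \<noteq> 0"
  shows "k + len u \<le> len v \<and> (k + len u = len v \<longrightarrow> (cover_step (set L))\<^sup>*\<^sup>* u v)"
  using assms
proof (induction L arbitrary: v k rule: rev_induct)
  case Nil
  then show ?case by (auto simp: delta_def split: if_splits)
next
  case (snoc \<gamma> L)
  let ?F = "fold arrow L (delta u)" and ?x = "refl \<gamma> \<circ> v"
  have \<gamma>: "pos \<gamma>" using snoc.prems by simp
  have mono: "(cover_step (set (L @ [\<gamma>])))\<^sup>*\<^sup>* a b" if "(cover_step (set L))\<^sup>*\<^sup>* a b" for a b
    using rtranclp_mono[of "cover_step (set L)" "cover_step (set (L @ [\<gamma>]))"] that
    by (fastforce simp: cover_step_def)
  consider "coeff (?F v) k \<noteq> 0"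
    | j where "\<not> pos (inv v \<gamma>)" "k = Suc j" "coeff (?F ?x) j \<noteq> 0"
    using snoc.prems(4) by (cases k) (auto simp: arrow_def[of \<gamma> _ v] split: if_splits)
  then show ?case
  proof cases
    case 1
    then show ?thesis using snoc.IH[of v k] snoc.prems mono by auto
  next
    case 2
    have x: "?x \<in> W" "len ?x < len v" using refl_descent[OF snoc.prems(3) \<gamma> 2(1)] by blast+
    have "j + len u \<le> len ?x \<and> (j + len u = len ?x \<longrightarrow> (cover_step (set L))\<^sup>*\<^sup>* u ?x)"
    proof (rule snoc.IH[OF _ snoc.prems(2) x(1) 2(3)])
      show "pos \<delta>" if "\<delta> \<in> set L" for \<delta> using snoc.prems(1) that by simp
    qed
    then have IH: "j + len u \<le> len ?x" "j + len u = len ?x \<longrightarrow> (cover_step (set L))\<^sup>*\<^sup>* u ?x"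
      by blast+
    have "(cover_step (set (L @ [\<gamma>])))\<^sup>*\<^sup>* u v" if "k + len u = len v"
    proof (rule rtranclp.rtrancl_into_rtrancl)
      show "(cover_step (set (L @ [\<gamma>])))\<^sup>*\<^sup>* u ?x"
        using mono IH x(2) 2(2) that by simp
      show "cover_step (set (L @ [\<gamma>])) ?x v"
        using IH(1) x(2) 2(2) that \<gamma> by (auto simp: cover_step_def)
    qed
    then show ?thesis using IH(1) x(2) 2(2) by simp
  qed
qed

text \<open>The number of saturated chains from \<open>u\<close> to \<open>v\<close> whose labels form a subsequence of \<open>L\<close>.  The truncated
  difference is harmless: no upward path leads from \<open>u\<close> to a shorter element.\<close>

definition top_coeff :: "'a list \<Rightarrow> ('a \<Rightarrow> 'a) \<Rightarrow> ('a \<Rightarrow> 'a) \<Rightarrow> nat" where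
  "top_coeff L u v = coeff (fold arrow L (delta u) v) (len v - len u)"

lemma top_coeff_chain:
  assumes "\<And>\<gamma>. \<gamma> \<in> set L \<Longrightarrow> pos \<gamma>" "u \<in> W" "v \<in> W" "top_coeff L u v \<noteq> 0"
  shows "len u \<le> len v" "(cover_step (set L))\<^sup>*\<^sup>* u v"
proof -
  have *: "len v - len u + len u \<le> len v"
    "len v - len u + len u = len v \<longrightarrow> (cover_step (set L))\<^sup>*\<^sup>* u v"
    using coeff_fold_arrow[OF assms(1-3)] assms(4) by (auto simp: top_coeff_def)
  then show "len u \<le> len v" by linarith
  then show "(cover_step (set L))\<^sup>*\<^sup>* u v" using * by simp
qed

lemma gallery_append: "gallery w L w' \<Longrightarrow> gallery w' L' w'' \<Longrightarrow> gallery w (L @ L') w''"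
  by (induction rule: gallery.induct) (auto intro: gallery.intros)

text \<open>The only saturated chain from \<open>u\<close> to \<open>v\<close> that follows \<open>L @ L'\<close> splits at exactly one element \<open>m\<close>.  In
  terms of counts, a sum of products of natural numbers over all possible \<open>m\<close> equals one.\<close>

lemma unique_peak:
  assumes gal: "gallery id L w" "gallery w L' t" and t: "t \<in> W" "\<And>\<gamma>. pos \<gamma> \<Longrightarrow> \<not> pos (t \<gamma>)"
    and le: "le u v"
  shows "\<exists>!m. m \<in> W \<and> top_coeff L u m \<noteq> 0 \<and> top_coeff L' m v \<noteq> 0"
proof -
  have u: "u \<in> W" and v: "v \<in> W" using le le_in_W by blast+
  have luv: "len u \<le> len v" using le_len[OF le] by auto
  have L: "\<And>\<gamma>. \<gamma> \<in> set L \<Longrightarrow> pos \<gamma>" and L': "\<And>\<gamma>. \<gamma> \<in> set L' \<Longrightarrow> pos \<gamma>" "set L' \<subseteq> \<Phi>"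
    using gallery_labels gal pos_root by blast+
  let ?d = "len v - len u"
  let ?A = "fold arrow L (delta u)" and ?B = "\<lambda>m. fold arrow L' (delta m) v"
  have prod: "coeff (?A m * ?B m) ?d = top_coeff L u m * top_coeff L' m v" if m: "m \<in> W" for m
  proof -
    \<comment> \<open>Both factors are at their degree bounds, so one term of the convolution survives.\<close>
    have only: "i = len m - len u \<and> ?d - i = len v - len m \<and> len u \<le> len m \<and> len m \<le> len v"
      if "coeff (?A m) i * coeff (?B m) (?d - i) \<noteq> 0" "i \<le> ?d" for i
    proof -
      have "i + len u \<le> len m" "?d - i + len m \<le> len v"
        using coeff_fold_arrow[of L u m i] coeff_fold_arrow[of L' m v "?d - i"] L L'(1) u m v that
        by auto
      then show ?thesis using that(2) luv by linarith
    qed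
    show ?thesis
    proof (cases "len u \<le> len m \<and> len m \<le> len v")
      case True
      let ?i = "len m - len u"
      have "coeff (?A m * ?B m) ?d = (\<Sum>i\<in>{?i}. coeff (?A m) i * coeff (?B m) (?d - i))"
        unfolding coeff_mult
      proof (rule sum.mono_neutral_right)
        show "\<forall>i\<in>{..?d} - {?i}. coeff (?A m) i * coeff (?B m) (?d - i) = 0"
          using only by blast
      qed (use True in auto)
      moreover have "?d - ?i = len v - len m" using True by simp
      ultimately show ?thesis by (simp add: top_coeff_def)
    next
      case False
      then have "coeff (?A m * ?B m) ?d = 0"
        unfolding coeff_mult using only by (intro sum.neutral) blast
      moreover have "top_coeff L u m * top_coeff L' m v = 0"
        using False top_coeff_chain(1)[of L u m] top_coeff_chain(1)[of L' m v] L L'(1) u m v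
        by auto
      ultimately show ?thesis by simp
    qed
  qed
  have "1 = coeff (fold arrow (L @ L') (delta u) v) ?d"
    using coeff_fold_arrow_longest[OF gallery_append[OF gal] t u v, of ?d] le luv by simp
  also have "\<dots> = (\<Sum>m\<in>W. coeff (?A m * ?B m) ?d)"
    using fold_arrow_sum[OF L'(2) v, of ?A] by (simp add: coeff_sum)
  also have "\<dots> = (\<Sum>m\<in>W. top_coeff L u m * top_coeff L' m v)"
    using prod by simp
  finally have "(\<Sum>m\<in>W. top_coeff L u m * top_coeff L' m v) = 1" ..
  then obtain m where "m \<in> W" "top_coeff L u m * top_coeff L' m v = 1"
    "\<forall>m'\<in>W. m \<noteq> m' \<longrightarrow> top_coeff L u m' * top_coeff L' m' v = 0"
    using sum_eq_1_iff[OF finite_W] by auto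
  then show ?thesis by (intro ex1I[of _ m]) auto
qed

section \<open>Cover steps that improve a linear functional\<close>

lemma cover_step_pos:
  assumes x: "x \<in> W" and "cover_step S x y"
  obtains \<gamma> where "\<gamma> \<in> S" "pos \<gamma>" "pos (inv x \<gamma>)" "y = refl \<gamma> \<circ> x"
proof -
  obtain \<gamma> where \<gamma>: "\<gamma> \<in> S" "pos \<gamma>" "y = refl \<gamma> \<circ> x" "len y = len x + 1"
    using assms(2) by (auto simp: cover_step_def)
  then have "pos (inv x \<gamma>)" using len_reflection_iff[OF x \<gamma>(2)] by simp
  then show thesis using that \<gamma> by blast
qed

lemma cover_step_covers:
  assumes x: "x \<in> W" and step: "cover_step S x y"
  shows "bruhat_covers \<Phi> \<Delta> x y"
proof -
  have "le x y" using cover_step_pos[OF assms] reflection_le[OF x] by metis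
  moreover have l: "len y = len x + 1" using step by (simp add: cover_step_def)
  moreover have "z = x \<or> z = y" if "le x z" "le z y" for z
    using le_len[OF that(1)] le_len[OF that(2)] l by auto
  ultimately show ?thesis by (auto simp: bruhat_covers_def)
qed

lemma cover_step_le: "\<lbrakk>x \<in> W; cover_step S x y\<rbrakk> \<Longrightarrow> le x y"
  using cover_step_covers by (auto simp: bruhat_covers_def)

lemma cover_steps_le:
  assumes "(cover_step S)\<^sup>*\<^sup>* x y" "x \<in> W"
  shows "le x y"
  using assms
proof induction
  case base
  then show ?case by (rule le_refl)
next
  case (step y z)
  then show ?case using cover_step_le le_in_W(2) le_trans by blast
qed

lemma cover_step_weight:
  assumes x: "x \<in> W" and y: "y = refl \<gamma> \<circ> x" and \<gamma>: "pos (inv x \<gamma>)"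
    and dom: "\<And>\<beta>. pos \<beta> \<Longrightarrow> 0 \<le> \<mu> \<bullet> \<beta>"
  obtains c where "0 \<le> c" "y \<mu> = x \<mu> - c *\<^sub>R \<gamma>"
proof
  show "0 \<le> cartan_pairing (x \<mu>) \<gamma>"
    using dom[OF \<gamma>] by (simp add: cartan_pairing_def W_inner_left[OF x])
  show "y \<mu> = x \<mu> - cartan_pairing (x \<mu>) \<gamma> *\<^sub>R \<gamma>"
    using y by (simp add: root_reflection_def)
qed

definition improves :: "('a \<Rightarrow> 'a) \<Rightarrow> ('a \<Rightarrow> 'a) \<Rightarrow> 'a \<Rightarrow> 'a \<Rightarrow> ('a \<Rightarrow> 'a) \<Rightarrow> ('a \<Rightarrow> 'a) \<Rightarrow> bool" where
  "improves u v f \<mu> x y \<longleftrightarrow> le u x \<and> le x v \<and> le u y \<and> le y v \<and>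
     (bruhat_covers \<Phi> \<Delta> x y \<or> bruhat_covers \<Phi> \<Delta> y x) \<and> f \<bullet> x \<mu> \<le> f \<bullet> y \<mu>"

text \<open>An upward step with label \<open>\<gamma>\<close> moves \<open>x \<mu>\<close> by a nonpositive multiple of \<open>\<gamma>\<close>, which improves the value
  of \<open>f\<close>.  As \<open>w \<gamma>\<close> is negative, the same step goes downward after multiplication by \<open>w\<close>.  The
  length of \<open>w x\<close> makes the search for the optimum terminate; the values of \<open>f\<close> cannot serve for that
  purpose, since they stay constant along a step whose two ends send \<open>\<mu>\<close> to the same point.\<close>

lemma ascending_chain_improves:
  assumes chain: "(cover_step S)\<^sup>*\<^sup>* z m" and z: "z \<in> W" "le u z" and m: "le m v"
    and w: "w \<in> W" and S: "\<And>\<gamma>. \<gamma> \<in> S \<Longrightarrow> f \<bullet> \<gamma> < 0 \<and> pos (- w \<gamma>)"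
    and dom: "\<And>\<beta>. pos \<beta> \<Longrightarrow> 0 \<le> \<mu> \<bullet> \<beta>"
  shows "(improves u v f \<mu>)\<^sup>*\<^sup>* z m \<and> (z = m \<or> len (w \<circ> m) < len (w \<circ> z))"
  using chain z
proof (induction rule: converse_rtranclp_induct)
  case base
  then show ?case by simp
next
  case (step x y)
  obtain \<gamma> where \<gamma>: "\<gamma> \<in> S" "pos \<gamma>" "pos (inv x \<gamma>)" "y = refl \<gamma> \<circ> x"
    using cover_step_pos[OF step.prems(1) step.hyps(1)] by blast
  have xy: "le x y" using cover_step_le step.prems(1) step.hyps(1) by blast
  have y: "y \<in> W" using le_in_W(2)[OF xy] .
  have uy: "le u y" using le_trans[OF step.prems(2) xy] .
  have yv: "le y v" using le_trans[OF cover_steps_le[OF step.hyps(2) y] m] .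
  have IH: "(improves u v f \<mu>)\<^sup>*\<^sup>* y m" "y = m \<or> len (w \<circ> m) < len (w \<circ> y)"
    using step.IH[OF y uy] by blast+
  obtain c where c: "0 \<le> c" "y \<mu> = x \<mu> - c *\<^sub>R \<gamma>"
    using cover_step_weight[OF step.prems(1) \<gamma>(4,3) dom] by blast
  have "c * (f \<bullet> \<gamma>) \<le> 0" using c(1) S[OF \<gamma>(1)] by (simp add: mult_nonneg_nonpos)
  then have "f \<bullet> x \<mu> \<le> f \<bullet> y \<mu>" using c(2) by (simp add: inner_diff_right)
  then have "improves u v f \<mu> x y"
    using step.prems(2) le_trans[OF xy yv] uy yv cover_step_covers[OF step.prems(1) step.hyps(1)]
    by (simp add: improves_def)
  moreover have "len (w \<circ> y) < len (w \<circ> x)"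
  proof -
    have wx: "w \<circ> x \<in> W" using w step.prems(1) comp_in_W by blast
    have "inv (w \<circ> x) (- w \<gamma>) = - inv x \<gamma>"
      using w step.prems(1) by (simp add: W_comp_inv W_minus[OF inv_in_W])
    then have "\<not> pos (inv (w \<circ> x) (- w \<gamma>))" using \<gamma>(3) not_pos_and_neg[OF \<gamma>(3)] by auto
    then have "len (refl (- w \<gamma>) \<circ> (w \<circ> x)) < len (w \<circ> x)"
      using refl_descent(2)[OF wx] S[OF \<gamma>(1)] by blast
    moreover have "refl (- w \<gamma>) \<circ> (w \<circ> x) = w \<circ> y"
      using W_refl[OF w, of \<gamma>] \<gamma>(4) by (simp flip: comp_assoc)
    ultimately show ?thesis by simp
  qed
  ultimately have "(improves u v f \<mu>)\<^sup>*\<^sup>* x m" "len (w \<circ> m) < len (w \<circ> x)"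
    using IH converse_rtranclp_into_rtranclp[of "improves u v f \<mu>" x y m] by auto
  then show ?case by blast
qed

text \<open>The mirror image: a downward step improves for labels with \<open>f > 0\<close>, and \<open>w\<close> keeps its direction.\<close>

lemma descending_chain_improves:
  assumes chain: "(cover_step S)\<^sup>*\<^sup>* m z" and m: "m \<in> W" "le u m" and z: "le z v"
    and w: "w \<in> W" and S: "\<And>\<gamma>. \<gamma> \<in> S \<Longrightarrow> 0 < f \<bullet> \<gamma> \<and> pos (w \<gamma>)"
    and dom: "\<And>\<beta>. pos \<beta> \<Longrightarrow> 0 \<le> \<mu> \<bullet> \<beta>"
  shows "(improves u v f \<mu>)\<^sup>*\<^sup>* z m \<and> (z = m \<or> len (w \<circ> m) < len (w \<circ> z))"
  using chain z
proof (induction rule: rtranclp_induct)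
  case base
  then show ?case by simp
next
  case (step x y)
  have mx: "le m x" using cover_steps_le[OF step.hyps(1) m(1)] .
  have x: "x \<in> W" using le_in_W(2)[OF mx] .
  obtain \<gamma> where \<gamma>: "\<gamma> \<in> S" "pos \<gamma>" "pos (inv x \<gamma>)" "y = refl \<gamma> \<circ> x"
    using cover_step_pos[OF x step.hyps(2)] by blast
  have xy: "le x y" using cover_step_le[OF x step.hyps(2)] .
  have ux: "le u x" using le_trans[OF m(2) mx] .
  have xv: "le x v" using le_trans[OF xy step.prems] .
  have IH: "(improves u v f \<mu>)\<^sup>*\<^sup>* x m" "x = m \<or> len (w \<circ> m) < len (w \<circ> x)"
    using step.IH[OF xv] by blast+
  obtain c where c: "0 \<le> c" "y \<mu> = x \<mu> - c *\<^sub>R \<gamma>"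
    using cover_step_weight[OF x \<gamma>(4,3) dom] by blast
  have "0 \<le> c * (f \<bullet> \<gamma>)" using c(1) S[OF \<gamma>(1)] by simp
  then have "f \<bullet> y \<mu> \<le> f \<bullet> x \<mu>" using c(2) by (simp add: inner_diff_right)
  then have "improves u v f \<mu> y x"
    using le_trans[OF ux xy] step.prems ux xv cover_step_covers[OF x step.hyps(2)]
    by (simp add: improves_def)
  moreover have "len (w \<circ> x) < len (w \<circ> y)"
  proof -
    have wx: "w \<circ> x \<in> W" using w x comp_in_W by blast
    have "inv (w \<circ> x) (w \<gamma>) = inv x \<gamma>" using w x by (simp add: W_comp_inv)
    then have "len (w \<circ> x) < len (refl (w \<gamma>) \<circ> (w \<circ> x))"
      using len_reflection_iff[OF wx] S[OF \<gamma>(1)] \<gamma>(3) by simp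
    moreover have "refl (w \<gamma>) \<circ> (w \<circ> x) = w \<circ> y"
      using W_refl[OF w, of \<gamma>] \<gamma>(4) by (simp flip: comp_assoc)
    ultimately show ?thesis by simp
  qed
  ultimately have "(improves u v f \<mu>)\<^sup>*\<^sup>* y m" "len (w \<circ> m) < len (w \<circ> y)"
    using IH converse_rtranclp_into_rtranclp[of "improves u v f \<mu>" y x m] by auto
  then show ?case by blast
qed

text \<open>A maximal gallery with labels \<open>f < 0\<close> ends at some \<open>w\<close> for which \<open>w f\<close> is strictly dominant.  Hence all
  labels of its continuation to the longest element satisfy \<open>f > 0\<close>.\<close>

lemma common_optimum:
  assumes gen: "\<And>\<gamma>. \<gamma> \<in> \<Phi> \<Longrightarrow> f \<bullet> \<gamma> \<noteq> 0" and dom: "\<And>\<beta>. pos \<beta> \<Longrightarrow> 0 \<le> \<mu> \<bullet> \<beta>"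
    and uv: "le u v"
  obtains m where "\<And>z. le u z \<Longrightarrow> le z v \<Longrightarrow> (improves u v f \<mu>)\<^sup>*\<^sup>* z m"
proof -
  obtain L w where gal: "gallery id L w"
    and L: "\<forall>\<gamma>\<in>set L. pos \<gamma> \<and> pos (id \<gamma>) \<and> \<gamma> \<in> {\<gamma>. f \<bullet> \<gamma> < 0}"
    and inversions: "\<forall>\<gamma>. pos \<gamma> \<longrightarrow> (pos (w \<gamma>) \<longleftrightarrow> pos (id \<gamma>) \<and> \<gamma> \<notin> set L)"
    and max: "\<forall>\<alpha>\<in>\<Delta>. pos (inv w \<alpha>) \<longrightarrow> inv w \<alpha> \<notin> {\<gamma>. f \<bullet> \<gamma> < 0}"
    using ex_maximal_gallery[OF id_in_W, of "{\<gamma>. f \<bullet> \<gamma> < 0}"] by blast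
  have w: "w \<in> W" using gallery_end_in_W[OF gal] by simp
  obtain L' t where gal': "gallery w L' t" and t1: "t \<in> W"
    and L': "\<forall>\<gamma>\<in>set L'. pos \<gamma> \<and> pos (w \<gamma>)" and t2: "\<forall>\<gamma>. pos \<gamma> \<longrightarrow> \<not> pos (t \<gamma>)"
    using gallery_to_longest[OF w] .
  note t = t1 t2[rule_format]
  have neg: "f \<bullet> \<gamma> < 0 \<and> pos (- w \<gamma>)" if "\<gamma> \<in> set L" for \<gamma>
  proof -
    have "\<gamma> \<in> \<Phi>" "\<not> pos (w \<gamma>)" "f \<bullet> \<gamma> < 0" using L inversions that pos_root by auto
    then show ?thesis using pos_uminus[OF W_root[OF w]] by blast
  qed
  have simple: "0 < w f \<bullet> \<alpha>" if \<alpha>: "\<alpha> \<in> \<Delta>" for \<alpha>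
  proof -
    have root: "inv w \<alpha> \<in> \<Phi>" using W_root[OF inv_in_W[OF w] simple_root[OF \<alpha>]] .
    have "\<not> f \<bullet> inv w \<alpha> < 0"
    proof
      assume less: "f \<bullet> inv w \<alpha> < 0"
      then have "pos (- inv w \<alpha>)" using max \<alpha> pos_uminus[OF root] by blast
      moreover have "\<not> pos (w (- inv w \<alpha>))"
        using W_minus[OF w] w not_pos_and_neg[OF pos_simple[OF \<alpha>]] by auto
      ultimately have "- inv w \<alpha> \<in> set L" using inversions by simp
      then show False using neg[of "- inv w \<alpha>"] less by simp
    qed
    then show ?thesis using gen[OF root] by (simp add: W_inner_left[OF w])
  qed
  have pos': "0 < f \<bullet> \<gamma> \<and> pos (w \<gamma>)" if "\<gamma> \<in> set L'" for \<gamma>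
  proof -
    have "pos (w \<gamma>)" using L' that by blast
    from pos_inner[OF this simple] show ?thesis using \<open>pos (w \<gamma>)\<close> by (simp add: W_inner[OF w])
  qed
  have labels: "\<And>\<gamma>. \<gamma> \<in> set L \<Longrightarrow> pos \<gamma>" "\<And>\<gamma>. \<gamma> \<in> set L' \<Longrightarrow> pos \<gamma>" using L L' by auto
  let ?peak = "\<lambda>u v m. m \<in> W \<and> top_coeff L u m \<noteq> 0 \<and> top_coeff L' m v \<noteq> 0"
  obtain m where unique: "\<And>m'. ?peak u v m' \<Longrightarrow> m' = m"
    using unique_peak[OF gal gal' t uv] by blast
  have "(improves u v f \<mu>)\<^sup>*\<^sup>* z m" if "le u z" "le z v" for z
    using that
  proof (induction "len (w \<circ> z)" arbitrary: z rule: less_induct)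
    case less
    have u: "u \<in> W" and z: "z \<in> W" and v: "v \<in> W" using less.prems le_in_W by blast+
    obtain m1 where m1: "?peak z v m1" using unique_peak[OF gal gal' t less.prems(2)] by blast
    obtain m2 where m2: "?peak u z m2" using unique_peak[OF gal gal' t less.prems(1)] by blast
    have up: "(cover_step (set L))\<^sup>*\<^sup>* z m1" "(cover_step (set L'))\<^sup>*\<^sup>* m1 v"
      using top_coeff_chain(2) labels m1 z v by blast+
    have down: "(cover_step (set L))\<^sup>*\<^sup>* u m2" "(cover_step (set L'))\<^sup>*\<^sup>* m2 z"
      using top_coeff_chain(2) labels m2 u z by blast+
    have b1: "le z m1" "le m1 v" and b2: "le u m2" "le m2 z"
      using cover_steps_le up down m1 m2 z u by blast+
    have i1: "(improves u v f \<mu>)\<^sup>*\<^sup>* z m1" "z = m1 \<or> len (w \<circ> m1) < len (w \<circ> z)"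
      using ascending_chain_improves[OF up(1) z less.prems(1) b1(2) w neg dom] by blast+
    have i2: "(improves u v f \<mu>)\<^sup>*\<^sup>* z m2" "z = m2 \<or> len (w \<circ> m2) < len (w \<circ> z)"
      using descending_chain_improves[OF down(2) _ b2(1) less.prems(2) w pos' dom] m2 by blast+
    \<comment> \<open>If \<open>z\<close> is the peak of \<open>[z, v]\<close> and of \<open>[u, z]\<close>, the two half chains show that it is that of \<open>[u, v]\<close>.\<close>
    consider "z \<noteq> m1" | "z \<noteq> m2" | "z = m1" "z = m2" by blast
    then show ?case
    proof cases
      case 1
      then show ?thesis
        using less.hyps[of m1] i1 le_trans[OF less.prems(1) b1(1)] b1(2) by auto
    next
      case 2
      then show ?thesis
        using less.hyps[of m2] i2 le_trans[OF b2(2) less.prems(2)] b2(1) by auto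
    next
      case 3
      then have "?peak u v z" using m1 m2 z by blast
      then show ?thesis using unique by blast
    qed
  qed
  then show thesis using that by blast
qed

end

section \<open>Edges of polytopes inscribed in a sphere\<close>

text \<open>The positivity conditions define an open set, whereas the functionals that vanish on some element of
  \<open>R\<close> form a finite union of hyperplanes, which is a null set.\<close>

lemma generic_functional:
  fixes g :: "'a::euclidean_space"
  assumes "finite P" "\<And>p. p \<in> P \<Longrightarrow> 0 < g \<bullet> p" "finite R" "0 \<notin> R"
  obtains f where "\<And>p. p \<in> P \<Longrightarrow> 0 < f \<bullet> p" "\<And>\<gamma>. \<gamma> \<in> R \<Longrightarrow> f \<bullet> \<gamma> \<noteq> 0"
proof -
  let ?O = "\<Inter>p\<in>P. {f. p \<bullet> f > 0}" and ?N = "\<Union>\<gamma>\<in>R. {f. \<gamma> \<bullet> f = 0}"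
  have "open ?O" using assms(1) by (intro open_INT ballI open_halfspace_gt)
  moreover have "g \<in> ?O" using assms(2) by (simp add: inner_commute)
  moreover have "negligible ?N"
    using assms(3,4) by (intro negligible_Union) (auto intro!: negligible_hyperplane)
  ultimately have "\<not> ?O \<subseteq> ?N"
    using open_not_negligible negligible_subset by blast
  then obtain f where "f \<in> ?O" "f \<notin> ?N" by blast
  then show thesis by (intro that[of f]) (auto simp: inner_commute)
qed

lemma small_perturbation:
  fixes a d :: "'a::euclidean_space"
  assumes "finite P" "\<And>p. p \<in> P \<Longrightarrow> 0 < a \<bullet> p"
  obtains \<epsilon> where "0 < \<epsilon>" "\<And>p. p \<in> P \<Longrightarrow> 0 < (a + \<epsilon> *\<^sub>R d) \<bullet> p"
proof -
  have "\<forall>\<^sub>F \<epsilon> in at_right 0. 0 < (a + \<epsilon> *\<^sub>R d) \<bullet> p" if "p \<in> P" for p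
  proof -
    have "((\<lambda>\<epsilon>. (a + \<epsilon> *\<^sub>R d) \<bullet> p) \<longlongrightarrow> (a + 0 *\<^sub>R d) \<bullet> p) (at_right 0)"
      by (intro tendsto_intros)
    then show ?thesis using assms(2)[OF that] by (auto dest: order_tendstoD(1))
  qed
  then have "\<forall>\<^sub>F \<epsilon> in at_right 0. \<forall>p\<in>P. 0 < (a + \<epsilon> *\<^sub>R d) \<bullet> p"
    using assms(1) by (simp add: eventually_ball_finite)
  then have "\<forall>\<^sub>F \<epsilon> in at_right 0. 0 < \<epsilon> \<and> (\<forall>p\<in>P. 0 < (a + \<epsilon> *\<^sub>R d) \<bullet> p)"
    using eventually_at_right_less by (rule eventually_conj[rotated])
  then obtain \<epsilon> :: real where "0 < \<epsilon> \<and> (\<forall>p\<in>P. 0 < (a + \<epsilon> *\<^sub>R d) \<bullet> p)"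
    using eventually_happens'[OF trivial_limit_at_right_real] by blast
  then show thesis using that by blast
qed

text \<open>The endpoints of the segment \<open>E\<close> are extreme points and thus belong to \<open>S\<close>, and points strictly
  between them lie strictly inside the sphere.\<close>

lemma edge_of_spherical_hull:
  fixes S :: "'a::euclidean_space set"
  assumes "finite S" and norm: "\<And>x. x \<in> S \<Longrightarrow> norm x = c" and E: "E edge_of convex hull S"
  obtains p q where "p \<noteq> q" "E = convex hull {p, q}" "S \<inter> E = {p, q}"
proof -
  have face: "E face_of convex hull S" and dim: "aff_dim E = 1" using E by (auto simp: edge_of_def)
  have "compact E" "convex E"
    using face face_of_imp_compact[OF convex_convex_hull] face_of_imp_convex assms(1)
      finite_imp_compact_convex_hull by blast+
  moreover have "E \<noteq> {}" "collinear E" using dim by (auto simp: collinear_aff_dim)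
  ultimately obtain p q where seg: "E = closed_segment p q"
    using compact_convex_collinear_segment by blast
  have "p \<noteq> q" using dim seg by auto
  have "p extreme_point_of E" "q extreme_point_of E"
    using seg by (auto simp: extreme_point_of_segment)
  then have pq: "p \<in> S" "q \<in> S"
    using extreme_point_of_face[OF face] extreme_point_of_convex_hull by blast+
  have "x = p \<or> x = q" if "x \<in> S" "x \<in> E" for x
  proof (rule ccontr)
    assume "\<not> (x = p \<or> x = q)"
    then have "x \<in> open_segment p q" using that seg by (auto simp: open_segment_def)
    then have "dist 0 x < dist 0 p \<or> dist 0 x < dist 0 q" by (rule dist_decreases_open_segment)
    then show False using norm that(1) pq by (simp add: dist_norm)
  qed
  then have "S \<inter> E = {p, q}" using pq seg by auto
  then show thesis using that \<open>p \<noteq> q\<close> seg by (simp add: segment_convex_hull)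
qed

text \<open>Tilting the functional that exposes \<open>E\<close> in the direction \<open>q - p\<close> separates \<open>p\<close> from \<open>q\<close>; a
  small tilt does not disturb the points off \<open>E\<close>.\<close>

lemma functional_of_edge:
  fixes S :: "'a::euclidean_space set"
  assumes S: "finite S" and face: "E face_of convex hull S"
    and pq: "p \<noteq> q" "S \<inter> E = {p, q}" and R: "finite R" "0 \<notin> R"
  obtains f where "f \<bullet> p < f \<bullet> q" "\<And>x. x \<in> S \<Longrightarrow> f \<bullet> p \<le> f \<bullet> x \<Longrightarrow> x = p \<or> x = q"
    "\<And>\<gamma>. \<gamma> \<in> R \<Longrightarrow> f \<bullet> \<gamma> \<noteq> 0"
proof -
  have "E exposed_face_of convex hull S"
    using face S by (simp add: exposed_face_of_polyhedron polytope_imp_polyhedron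
        polytope_convex_hull)
  then obtain a b where ab: "convex hull S \<subseteq> {x. a \<bullet> x \<le> b}" "E = convex hull S \<inter> {x. a \<bullet> x = b}"
    by (auto simp: exposed_face_of_def)
  let ?P = "(\<lambda>x. p - x) ` (S - E)"
  have p: "a \<bullet> p = b" and q: "a \<bullet> q = b" using pq(2) ab(2) by auto
  have "0 < a \<bullet> y" if y: "y \<in> ?P" for y
  proof -
    obtain x where x: "x \<in> S" "x \<notin> E" "y = p - x" using y by blast
    have "x \<in> convex hull S" using x(1) by (simp add: hull_inc)
    then have "a \<bullet> x \<le> b" "a \<bullet> x \<noteq> b" using ab x(2) by auto
    then show ?thesis using p x(3) by (simp add: inner_diff_right)
  qed
  then obtain \<epsilon> where \<epsilon>: "0 < \<epsilon>" "\<And>y. y \<in> ?P \<Longrightarrow> 0 < (a + \<epsilon> *\<^sub>R (q - p)) \<bullet> y"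
    using small_perturbation[of ?P a "q - p"] S by blast
  moreover have "0 < (a + \<epsilon> *\<^sub>R (q - p)) \<bullet> (q - p)"
    using \<epsilon>(1) p q pq(1) by (simp add: inner_add_left inner_diff_right[of a])
  ultimately obtain f where f: "\<And>y. y \<in> insert (q - p) ?P \<Longrightarrow> 0 < f \<bullet> y"
    "\<And>\<gamma>. \<gamma> \<in> R \<Longrightarrow> f \<bullet> \<gamma> \<noteq> 0"
    using generic_functional[of "insert (q - p) ?P" "a + \<epsilon> *\<^sub>R (q - p)" R] S R by blast
  show thesis
  proof
    show "f \<bullet> p < f \<bullet> q" using f(1)[of "q - p"] by (simp add: inner_diff_right)
    show "x = p \<or> x = q" if x: "x \<in> S" "f \<bullet> p \<le> f \<bullet> x" for x
    proof (rule ccontr)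
      assume "\<not> (x = p \<or> x = q)"
      then have "p - x \<in> ?P" using x(1) pq(2) by blast
      then show False using f(1)[of "p - x"] x(2) by (simp add: inner_diff_right)
    qed
  qed (fact f(2))
qed

theorem corollary7p14:
  fixes \<Phi> \<Delta> J :: "'a::euclidean_space set" and u v :: "'a \<Rightarrow> 'a" and E :: "'a set"
  assumes "root_system \<Phi>"
    and "simple_roots \<Phi> \<Delta>"
    and "J \<subseteq> \<Delta>"
    and "u \<in> weyl_group \<Delta>"
    and "v \<in> min_coset_reps \<Delta> J"
    and "bruhat_le \<Phi> \<Delta> u v"
    and "E edge_of bruhat_interval_polytope \<Phi> \<Delta> J u v"
  shows "\<exists>x\<in>weyl_group \<Delta>. \<exists>y\<in>weyl_group \<Delta>.
           bruhat_covers \<Phi> \<Delta> x y \<and> E = convex hull {x (rho \<Delta> J), y (rho \<Delta> J)}"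
proof -
  interpret based_root_system \<Phi> \<Delta> using assms(1,2) by unfold_locales
  let ?\<rho> = "rho \<Delta> J"
  define S where "S = {z ?\<rho> | z. le u z \<and> le z v}"
  have "S \<subseteq> (\<lambda>z. z ?\<rho>) ` W" using le_in_W by (auto simp: S_def)
  then have finS: "finite S" using finite_W finite_surj by blast
  have E: "E edge_of convex hull S"
    using assms(7) by (simp add: S_def bruhat_interval_polytope_def)
  have "norm x = norm ?\<rho>" if "x \<in> S" for x
    using that W_norm le_in_W by (auto simp: S_def)
  then obtain p q where pq: "p \<noteq> q" "E = convex hull {p, q}" "S \<inter> E = {p, q}"
    using edge_of_spherical_hull[OF finS _ E] by blast
  obtain f where f: "f \<bullet> p < f \<bullet> q" and best: "\<And>x. x \<in> S \<Longrightarrow> f \<bullet> p \<le> f \<bullet> x \<Longrightarrow> x = p \<or> x = q"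
    and gen: "\<And>\<gamma>. \<gamma> \<in> \<Phi> \<Longrightarrow> f \<bullet> \<gamma> \<noteq> 0"
    using functional_of_edge[OF finS _ pq(1,3) finite_roots zero_notin_roots] E
    by (auto simp: edge_of_def)
  let ?R = "improves u v f ?\<rho>"
  obtain m where m: "\<And>z. le u z \<Longrightarrow> le z v \<Longrightarrow> ?R\<^sup>*\<^sup>* z m"
    using common_optimum[of f ?\<rho> u v] gen rho_dominant assms(6) by blast
  have mono: "f \<bullet> x ?\<rho> \<le> f \<bullet> y ?\<rho>" if "?R\<^sup>*\<^sup>* x y" for x y
    using that by induction (auto simp: improves_def)
  have inS: "y ?\<rho> \<in> S" if "?R x y" for x y
    using that by (auto simp: improves_def S_def)
  have "p \<in> S" "q \<in> S" using pq(3) by blast+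
  then obtain zp zq where zp: "zp ?\<rho> = p" "le u zp" "le zp v" and zq: "zq ?\<rho> = q" "le u zq" "le zq v"
    using \<open>p \<in> S\<close> \<open>q \<in> S\<close> unfolding S_def by blast
  have "m ?\<rho> = q"
  proof -
    have ge: "f \<bullet> q \<le> f \<bullet> m ?\<rho>" using mono[OF m[OF zq(2,3)]] zq(1) by simp
    have "m ?\<rho> \<in> S"
      using m[OF zq(2,3)] zq inS by (cases rule: rtranclp.cases) (auto simp: S_def)
    then show ?thesis using best[of "m ?\<rho>"] ge f by auto
  qed
  \<comment> \<open>A path that starts over \<open>p\<close> stays over \<open>{p, q}\<close>, because the values of \<open>f\<close> never drop below \<open>f p\<close>.\<close>
  moreover have "\<exists>x y. ?R x y \<and> x ?\<rho> = p \<and> y ?\<rho> = q"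
    if "?R\<^sup>*\<^sup>* z m" "z ?\<rho> = p" "m ?\<rho> = q" for z
    using that
  proof (induction rule: converse_rtranclp_induct)
    case base
    then show ?case using pq(1) by simp
  next
    case (step x y)
    have "f \<bullet> p \<le> f \<bullet> y ?\<rho>" using step.hyps(1) step.prems(1) by (auto simp: improves_def)
    then show ?case using best[OF inS[OF step.hyps(1)]] step by blast
  qed
  ultimately obtain x y where xy: "?R x y" "x ?\<rho> = p" "y ?\<rho> = q"
    using m[OF zp(2,3)] zp(1) by blast
  then have "x \<in> W" "y \<in> W" "bruhat_covers \<Phi> \<Delta> x y \<or> bruhat_covers \<Phi> \<Delta> y x"
    using le_in_W by (auto simp: improves_def)
  moreover have "E = convex hull {x ?\<rho>, y ?\<rho>}" "E = convex hull {y ?\<rho>, x ?\<rho>}"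
    using pq(2) xy by (simp_all add: insert_commute)
  ultimately show ?thesis by blast
qed

end
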